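(* Let $A$ and $B$ be quantum systems of any arbitrary finite dimension and let $\mathcal S$ be the SWAP channel between $A$ and $B$, regarded as a bipartite unitary channel with Alice's input $A$, Bob's input $B$, Alice's output $A'=B$ and Bob's output $B'=A$. Then $\mathcal S^{\otimes n}$ is a SWAP channel with $d_A$ replaced by $d_A^n$ and $d_B$ replaced by $d_B^n$, and $$\Sigma_\infty(\mathcal S)=\lim_{n\to\infty}\Sigma(\mathcal S^{\otimes n})=2\qquad\text{and}\qquad C_\infty(\mathcal S)=\lim_{n\to\infty}C(\mathcal S^{\otimes n})=2 .$$
   Context: All systems are finite-dimensional quantum systems; system $X$ has complex Hilbert space $\mathcal H_X$ of dimension $d_X$, and the composite system $XY$ has Hilbert space $\mathcal H_X\otimes\mathcal H_Y$. $\mathsf{St}(X)$ is the set of density operators on $\mathcal H_X$. $\mathfrak C(X,Y)$ is the set of quantum channels (completely positive trace-preserving linear maps) from operators on $\mathcal H_X$ to operators on $\mathcal H_Y$, and $\mathfrak C(X)=\mathfrak C(X,X)$. $\mathcal I_X$ is the identity channel on $X$. $\|X\|_1=\mathrm{Tr}\sqrt{X^\dagger X}$. For a Hermitian-preserving linear map $\mathcal L$ with input system $X$, the diamond norm is $\|\mathcal L\|_\diamond=\sup_{\rho\in\mathsf{St}(EX)}\|(\mathcal I_E\otimes\mathcal L)(\rho)\|_1$ with $E\cong X$. For a bipartite unitary channel $\mathcal U:\rho\mapsto U\rho U^\dagger$ with $U:\mathcal H_A\otimes\mathcal H_B\to\mathcal H_{A'}\otimes\mathcal H_{B'}$ unitary,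 let $\mathcal T(\mathcal U)=(\mathcal I_A\otimes\mathcal U)\circ(\mathcal S_{AA}\otimes\mathcal I_B)\circ(\mathcal I_A\otimes\mathcal U^{-1})\in\mathfrak C(AA'B')$, where $\mathcal S_{AA}$ is the swap of two copies of $A$. The signalling and the causal influence of $\mathcal U$ (from $A$ to $B'$) are $$\Sigma(\mathcal U)=\inf_{\mathcal C\in\mathfrak C(B,B')}\|(\mathrm{Tr}_{A'}\otimes\mathcal I_{B'})\circ\mathcal U-\mathrm{Tr}_A\otimes\mathcal C\|_\diamond,\qquad C(\mathcal U)=\inf_{\mathcal C\in\mathfrak C(AA')}\|\mathcal T(\mathcal U)-\mathcal C\otimes\mathcal I_{B'}\|_\diamond .$$ The tensor power $\mathcal U^{\otimes n}$ is regarded as a bipartite unitary channel with Alice's input $A^{\otimes n}$ and output $A'^{\otimes n}$, and Bob's input $B^{\otimes n}$ and output $B'^{\otimes n}$. The SWAP gate is the unitary $S:\mathcal H_A\otimes\mathcal H_B\to\mathcal H_B\otimes\mathcal H_A$, $S(|\psi\rangle\otimes|\varphi\rangle)=|\varphi\rangle\otimes|\psi\rangle$, and $\mathcal S$ is the corresponding channel $\rho\mapsto S\rho S^\dagger$.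
   Formalization: The two limits are stated only for d_A ≥ 2: for d_A = 1 Bob's output B' = A is trivial, so Σ and C of every S^{⊗n} are 0 and the limits are not 2. The claim that S^{⊗n} is a SWAP channel is kept for all d_A, d_B ≥ 1. *)

theory Defs
  imports Complex_Main "Jordan_Normal_Form.Schur_Decomposition"
begin

text \<open>
  A system of dimension \<open>d\<close> has Hilbert space \<open>\<complex>\<^sup>d\<close> (vectors in \<open>carrier_vec d\<close>), its operators
  are the elements of \<open>carrier_mat d d\<close>, and linear maps between operator spaces are functions
  \<open>cmat \<Rightarrow> cmat\<close> that matter only on the relevant carrier.  The composite of systems of dimensions
  \<open>d\<close> and \<open>e\<close> has dimension \<open>d * e\<close>; the product basis vector \<open>|i\<rangle> \<otimes> |j\<rangle>\<close> has index \<open>i * e + j\<close>,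
  so that composition of systems is strictly associative and the trivial system \<open>\<complex>\<^sup>1\<close> is a strict
  unit.
\<close>

type_synonym cmat = "complex mat"

section \<open>Operators\<close>

definition kron :: "cmat \<Rightarrow> cmat \<Rightarrow> cmat" where
  "kron A B = mat (dim_row A * dim_row B) (dim_col A * dim_col B)
     (\<lambda>(r, c). A $$ (r div dim_row B, c div dim_col B) * B $$ (r mod dim_row B, c mod dim_col B))"

definition kron_vec :: "complex vec \<Rightarrow> complex vec \<Rightarrow> complex vec" where
  "kron_vec v w = vec (dim_vec v * dim_vec w) (\<lambda>r. v $ (r div dim_vec w) * w $ (r mod dim_vec w))"

definition trace :: "cmat \<Rightarrow> complex" where
  "trace A = (\<Sum>i<dim_row A. A $$ (i, i))"

text \<open>The order on \<open>complex\<close> is the one of \<^theory>\<open>HOL-Library.Complex_Order\<close>: \<open>0 \<le> z\<close> says that \<open>z\<close> is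
  real and nonnegative, so Hermiticity is implied.\<close>

definition positive_op :: "nat \<Rightarrow> cmat \<Rightarrow> bool" where
  "positive_op d A \<longleftrightarrow> A \<in> carrier_mat d d \<and> (\<forall>v\<in>carrier_vec d. 0 \<le> (A *\<^sub>v v) \<bullet>c v)"

definition sqrt_op :: "cmat \<Rightarrow> cmat" where
  "sqrt_op A = (THE R. positive_op (dim_row A) R \<and> R * R = A)"

definition trace_norm :: "cmat \<Rightarrow> real" where
  "trace_norm X = Re (trace (sqrt_op (mat_adjoint X * X)))"

definition states :: "nat \<Rightarrow> cmat set" where
  "states d = {\<rho>. positive_op d \<rho> \<and> trace \<rho> = 1}"

section \<open>Linear maps on operators and channels\<close>

definition mat_unit :: "nat \<Rightarrow> nat \<Rightarrow> nat \<Rightarrow> cmat" where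
  "mat_unit d i j = mat d d (\<lambda>(r, c). if r = i \<and> c = j then 1 else 0)"

definition linear_map :: "nat \<Rightarrow> nat \<Rightarrow> (cmat \<Rightarrow> cmat) \<Rightarrow> bool" where
  "linear_map d d' F \<longleftrightarrow>
     (\<forall>X\<in>carrier_mat d d. F X \<in> carrier_mat d' d') \<and>
     (\<forall>X\<in>carrier_mat d d. \<forall>Y\<in>carrier_mat d d. F (X + Y) = F X + F Y) \<and>
     (\<forall>c. \<forall>X\<in>carrier_mat d d. F (c \<cdot>\<^sub>m X) = c \<cdot>\<^sub>m F X)"

text \<open>\<open>tensor_map d d' e e' F G\<close> is \<open>F \<otimes> G\<close> for \<open>F\<close> from dimension \<open>d\<close> to \<open>d'\<close> and \<open>G\<close> from
  dimension \<open>e\<close> to \<open>e'\<close>: the linear map that sends \<open>E\<^sub>i\<^sub>j \<otimes> E\<^sub>k\<^sub>l\<close> to \<open>F E\<^sub>i\<^sub>j \<otimes> G E\<^sub>k\<^sub>l\<close>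
  for all matrix units.  Lemma \<open>tensor_map_kron\<close> below gives its action on all product operators.\<close>

definition tensor_map ::
  "nat \<Rightarrow> nat \<Rightarrow> nat \<Rightarrow> nat \<Rightarrow> (cmat \<Rightarrow> cmat) \<Rightarrow> (cmat \<Rightarrow> cmat) \<Rightarrow> cmat \<Rightarrow> cmat" where
  "tensor_map d d' e e' F G \<rho> = mat (d' * e') (d' * e') (\<lambda>(r, c).
     \<Sum>i<d. \<Sum>j<d. \<Sum>k<e. \<Sum>l<e.
       \<rho> $$ (i * e + k, j * e + l) * kron (F (mat_unit d i j)) (G (mat_unit e k l)) $$ (r, c))"

definition completely_positive :: "nat \<Rightarrow> nat \<Rightarrow> (cmat \<Rightarrow> cmat) \<Rightarrow> bool" where
  "completely_positive d d' F \<longleftrightarrow>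
     (\<forall>k \<rho>. positive_op (k * d) \<rho> \<longrightarrow> positive_op (k * d') (tensor_map k k d d' id F \<rho>))"

definition trace_preserving :: "nat \<Rightarrow> (cmat \<Rightarrow> cmat) \<Rightarrow> bool" where
  "trace_preserving d F \<longleftrightarrow> (\<forall>X\<in>carrier_mat d d. trace (F X) = trace X)"

definition channels :: "nat \<Rightarrow> nat \<Rightarrow> (cmat \<Rightarrow> cmat) set" where
  "channels d d' = {F. linear_map d d' F \<and> completely_positive d d' F \<and> trace_preserving d F}"

definition trace_map :: "cmat \<Rightarrow> cmat" where
  "trace_map \<rho> = mat 1 1 (\<lambda>_. trace \<rho>)"

definition unitary_channel :: "cmat \<Rightarrow> cmat \<Rightarrow> cmat" where
  "unitary_channel U \<rho> = U * \<rho> * mat_adjoint U"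

definition diamond_norm :: "nat \<Rightarrow> nat \<Rightarrow> (cmat \<Rightarrow> cmat) \<Rightarrow> real" where
  "diamond_norm d d' L = (SUP \<rho>\<in>states (d * d). trace_norm (tensor_map d d d d' id L \<rho>))"

section \<open>The SWAP gate\<close>

definition swap_mat :: "nat \<Rightarrow> nat \<Rightarrow> cmat" where
  "swap_mat a b = mat (b * a) (a * b)
     (\<lambda>(r, c). if r div a = c mod b \<and> r mod a = c div b then 1 else 0)"

definition swap_channel :: "nat \<Rightarrow> nat \<Rightarrow> cmat \<Rightarrow> cmat" where
  "swap_channel a b = unitary_channel (swap_mat a b)"

section \<open>Signalling and causal influence\<close>

text \<open>Below, \<open>a b a' b'\<close> are the dimensions of \<open>A, B, A', B'\<close>, and \<open>\<U>\<close> is a bipartite unitary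
  channel from \<open>AB\<close> to \<open>A'B'\<close>.\<close>

definition inverse_channel :: "nat \<Rightarrow> (cmat \<Rightarrow> cmat) \<Rightarrow> cmat \<Rightarrow> cmat" where
  "inverse_channel d \<U> = inv_into (carrier_mat d d) \<U>"

definition T_channel ::
  "nat \<Rightarrow> nat \<Rightarrow> nat \<Rightarrow> nat \<Rightarrow> (cmat \<Rightarrow> cmat) \<Rightarrow> cmat \<Rightarrow> cmat" where
  "T_channel a b a' b' \<U> =
     tensor_map a a (a * b) (a' * b') id \<U>
     \<circ> tensor_map (a * a) (a * a) b b (swap_channel a a) id
     \<circ> tensor_map a a (a' * b') (a * b) id (inverse_channel (a * b) \<U>)"

definition signalling :: "nat \<Rightarrow> nat \<Rightarrow> nat \<Rightarrow> nat \<Rightarrow> (cmat \<Rightarrow> cmat) \<Rightarrow> real" where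
  "signalling a b a' b' \<U> = (INF \<C>\<in>channels b b'.
     diamond_norm (a * b) b'
       (\<lambda>\<rho>. tensor_map a' 1 b' b' trace_map id (\<U> \<rho>) - tensor_map a 1 b b' trace_map \<C> \<rho>))"

definition causal_influence :: "nat \<Rightarrow> nat \<Rightarrow> nat \<Rightarrow> nat \<Rightarrow> (cmat \<Rightarrow> cmat) \<Rightarrow> real" where
  "causal_influence a b a' b' \<U> = (INF \<C>\<in>channels (a * a') (a * a').
     diamond_norm (a * a' * b') (a * a' * b')
       (\<lambda>\<rho>. T_channel a b a' b' \<U> \<rho> - tensor_map (a * a') (a * a') b' b' \<C> id \<rho>))"

section \<open>Tensor powers of bipartite channels\<close>

text \<open>The unitary channel exchanging the two middle factors,
  \<open>\<complex>\<^sup>p \<otimes> \<complex>\<^sup>q \<otimes> \<complex>\<^sup>r \<otimes> \<complex>\<^sup>s \<rightarrow> \<complex>\<^sup>p \<otimes> \<complex>\<^sup>r \<otimes> \<complex>\<^sup>q \<otimes> \<complex>\<^sup>s\<close>.\<close>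

definition swap_middle :: "nat \<Rightarrow> nat \<Rightarrow> nat \<Rightarrow> nat \<Rightarrow> cmat \<Rightarrow> cmat" where
  "swap_middle p q r s = unitary_channel (kron (kron (1\<^sub>m p) (swap_mat q r)) (1\<^sub>m s))"

text \<open>\<open>tensor_power a b a' b' \<U> n\<close> is \<open>\<U>\<^sup>\<otimes>\<^sup>n\<close> with the factors regrouped so that the inputs are ordered
  \<open>A\<^sup>\<otimes>\<^sup>n B\<^sup>\<otimes>\<^sup>n\<close> and the outputs \<open>A'\<^sup>\<otimes>\<^sup>n B'\<^sup>\<otimes>\<^sup>n\<close>.  In the step, \<open>A\<^sup>\<otimes>\<^sup>n A B\<^sup>\<otimes>\<^sup>n B\<close> is rearranged to
  \<open>(A\<^sup>\<otimes>\<^sup>n B\<^sup>\<otimes>\<^sup>n) (A B)\<close>, then \<open>\<U>\<^sup>\<otimes>\<^sup>n \<otimes> \<U>\<close> is applied, and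
  \<open>(A'\<^sup>\<otimes>\<^sup>n B'\<^sup>\<otimes>\<^sup>n) (A' B')\<close> is rearranged to \<open>A'\<^sup>\<otimes>\<^sup>n A' B'\<^sup>\<otimes>\<^sup>n B'\<close>.\<close>

fun tensor_power ::
  "nat \<Rightarrow> nat \<Rightarrow> nat \<Rightarrow> nat \<Rightarrow> (cmat \<Rightarrow> cmat) \<Rightarrow> nat \<Rightarrow> cmat \<Rightarrow> cmat" where
  "tensor_power a b a' b' \<U> 0 = id"
| "tensor_power a b a' b' \<U> (Suc n) =
     swap_middle (a' ^ n) (b' ^ n) a' b'
     \<circ> tensor_map (a ^ n * b ^ n) (a' ^ n * b' ^ n) (a * b) (a' * b')
         (tensor_power a b a' b' \<U> n) \<U>
     \<circ> swap_middle (a ^ n) a (b ^ n) b"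

definition signalling_power ::
  "nat \<Rightarrow> nat \<Rightarrow> nat \<Rightarrow> nat \<Rightarrow> (cmat \<Rightarrow> cmat) \<Rightarrow> nat \<Rightarrow> real" where
  "signalling_power a b a' b' \<U> n =
     signalling (a ^ n) (b ^ n) (a' ^ n) (b' ^ n) (tensor_power a b a' b' \<U> n)"

definition causal_influence_power ::
  "nat \<Rightarrow> nat \<Rightarrow> nat \<Rightarrow> nat \<Rightarrow> (cmat \<Rightarrow> cmat) \<Rightarrow> nat \<Rightarrow> real" where
  "causal_influence_power a b a' b' \<U> n =
     causal_influence (a ^ n) (b ^ n) (a' ^ n) (b' ^ n) (tensor_power a b a' b' \<U> n)"

definition asymptotic_signalling :: "nat \<Rightarrow> nat \<Rightarrow> nat \<Rightarrow> nat \<Rightarrow> (cmat \<Rightarrow> cmat) \<Rightarrow> real" where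
  "asymptotic_signalling a b a' b' \<U> = lim (signalling_power a b a' b' \<U>)"

definition asymptotic_causal_influence ::
  "nat \<Rightarrow> nat \<Rightarrow> nat \<Rightarrow> nat \<Rightarrow> (cmat \<Rightarrow> cmat) \<Rightarrow> real" where
  "asymptotic_causal_influence a b a' b' \<U> = lim (causal_influence_power a b a' b' \<U>)"

section \<open>Characteristic properties of the encodings\<close>

lemma div_mod_less:
  fixes r :: nat
  assumes "r < m * n"
  shows "r div n < m" "r mod n < n"
proof -
  have "0 < n" using assms by (cases n) auto
  then show "r mod n < n" by simp
  show "r div n < m" using assms by (simp add: less_mult_imp_div_less)
qed

lemma swap_mat_kron_vec:
  assumes v: "v \<in> carrier_vec a" and w: "w \<in> carrier_vec b"
  shows "swap_mat a b *\<^sub>v kron_vec v w = kron_vec w v"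
proof (rule eq_vecI)
  show "dim_vec (swap_mat a b *\<^sub>v kron_vec v w) = dim_vec (kron_vec w v)"
    using v w by (simp add: swap_mat_def kron_vec_def)
next
  fix r assume "r < dim_vec (kron_vec w v)"
  then have r: "r < b * a" using v w by (simp add: kron_vec_def)
  let ?c = "(r mod a) * b + r div a"
  have d: "r div a < b" "r mod a < a" using div_mod_less[OF r] by auto
  have "?c < (r mod a) * b + b" using d(1) by simp
  also have "\<dots> = Suc (r mod a) * b" by simp
  also have "\<dots> \<le> a * b" using d(2) by (intro mult_right_mono) auto
  finally have c: "?c < a * b" .
  have uniq: "(r div a = c mod b \<and> r mod a = c div b) \<longleftrightarrow> c = ?c" for c
  proof
    assume "r div a = c mod b \<and> r mod a = c div b"
    then show "c = ?c" using div_mult_mod_eq[of c b] by simp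
  next
    assume "c = ?c"
    then show "r div a = c mod b \<and> r mod a = c div b" using d by simp
  qed
  have "(swap_mat a b *\<^sub>v kron_vec v w) $ r
      = (\<Sum>c = 0..<a * b. (if c = ?c then 1 else 0) * kron_vec v w $ c)"
    using r v w uniq by (simp add: swap_mat_def scalar_prod_def kron_vec_def)
  also have "\<dots> = (\<Sum>c = 0..<a * b. if c = ?c then kron_vec v w $ c else 0)"
    by (intro sum.cong) auto
  also have "\<dots> = kron_vec v w $ ?c"
    using c by simp
  also have "\<dots> = v $ (r mod a) * w $ (r div a)"
    using c v w d by (simp add: kron_vec_def)
  also have "\<dots> = kron_vec w v $ r"
    using r v w by (simp add: kron_vec_def)
  finally show "(swap_mat a b *\<^sub>v kron_vec v w) $ r = kron_vec w v $ r" .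
qed

lemma linear_map_entry_sum:
  assumes F: "linear_map d d' F" and fin: "finite S" and r: "r < d'" and c: "c < d'"
    and E: "\<And>p. p \<in> S \<Longrightarrow> E p \<in> carrier_mat d d"
  shows "F (mat d d (\<lambda>rc. \<Sum>p\<in>S. x p * E p $$ rc)) $$ (r, c) = (\<Sum>p\<in>S. x p * F (E p) $$ (r, c))"
  using fin E
proof (induction S rule: finite_induct)
  case empty
  have 0: "mat d d (\<lambda>rc. 0) = 0 \<cdot>\<^sub>m (0\<^sub>m d d :: cmat)" by (rule eq_matI) auto
  have "F (0 \<cdot>\<^sub>m (0\<^sub>m d d)) = 0 \<cdot>\<^sub>m F (0\<^sub>m d d)" and "F (0\<^sub>m d d) \<in> carrier_mat d' d'"
    using F unfolding linear_map_def by (blast intro: zero_carrier_mat)+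
  then have "F (0 \<cdot>\<^sub>m (0\<^sub>m d d)) $$ (r, c) = 0" using r c
    by (metis carrier_matD index_smult_mat(1) mult_zero_left)
  then show ?case by (simp only: 0 sum.empty)
next
  case (insert q S)
  let ?M = "mat d d (\<lambda>rc. \<Sum>p\<in>S. x p * E p $$ rc)"
  have Eq: "E q \<in> carrier_mat d d" using insert.prems by auto
  have decomp: "mat d d (\<lambda>rc. \<Sum>p\<in>insert q S. x p * E p $$ rc) = x q \<cdot>\<^sub>m E q + ?M"
    using insert.hyps Eq by (intro eq_matI) auto
  have "F (x q \<cdot>\<^sub>m E q + ?M) = F (x q \<cdot>\<^sub>m E q) + F ?M" "F (x q \<cdot>\<^sub>m E q) = x q \<cdot>\<^sub>m F (E q)"
    "F ?M \<in> carrier_mat d' d'" "F (E q) \<in> carrier_mat d' d'"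
    using F Eq unfolding linear_map_def by auto
  then show ?case using insert r c by (subst decomp) simp
qed

lemma linear_map_entry:
  assumes F: "linear_map d d' F" and X: "X \<in> carrier_mat d d" and r: "r < d'" and c: "c < d'"
  shows "F X $$ (r, c) = (\<Sum>i<d. \<Sum>j<d. X $$ (i, j) * F (mat_unit d i j) $$ (r, c))"
proof -
  let ?S = "{..<d} \<times> {..<d}"
  have "X = mat d d (\<lambda>rc. \<Sum>p\<in>?S. X $$ p * mat_unit d (fst p) (snd p) $$ rc)"
  proof (rule eq_matI)
    fix r c
    assume "r < dim_row (mat d d (\<lambda>rc. \<Sum>p\<in>?S. X $$ p * mat_unit d (fst p) (snd p) $$ rc))"
      "c < dim_col (mat d d (\<lambda>rc. \<Sum>p\<in>?S. X $$ p * mat_unit d (fst p) (snd p) $$ rc))"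
    then have rc: "r < d" "c < d" by auto
    have "(\<Sum>p\<in>?S. X $$ p * mat_unit d (fst p) (snd p) $$ (r, c))
        = (\<Sum>p\<in>?S. if p = (r, c) then X $$ p else 0)"
      using rc by (intro sum.cong) (auto simp: mat_unit_def)
    also have "\<dots> = X $$ (r, c)" using rc by simp
    finally show "X $$ (r, c) =
        mat d d (\<lambda>rc. \<Sum>p\<in>?S. X $$ p * mat_unit d (fst p) (snd p) $$ rc) $$ (r, c)"
      using rc by simp
  qed (use X in auto)
  then have "F X $$ (r, c)
      = F (mat d d (\<lambda>rc. \<Sum>p\<in>?S. X $$ p * mat_unit d (fst p) (snd p) $$ rc)) $$ (r, c)"
    by simp
  also have "\<dots> = (\<Sum>p\<in>?S. X $$ p * F (mat_unit d (fst p) (snd p)) $$ (r, c))"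
    by (rule linear_map_entry_sum[OF F _ r c]) (auto simp: mat_unit_def)
  finally show ?thesis by (simp add: sum.cartesian_product case_prod_beta)
qed

lemma tensor_map_kron:
  assumes F: "linear_map d d' F" and G: "linear_map e e' G"
    and X: "X \<in> carrier_mat d d" and Y: "Y \<in> carrier_mat e e"
  shows "tensor_map d d' e e' F G (kron X Y) = kron (F X) (G Y)"
proof -
  have FE: "F (mat_unit d i j) \<in> carrier_mat d' d'" for i j
    using F unfolding linear_map_def by (auto simp: mat_unit_def)
  have GE: "G (mat_unit e i j) \<in> carrier_mat e' e'" for i j
    using G unfolding linear_map_def by (auto simp: mat_unit_def)
  have FX: "F X \<in> carrier_mat d' d'" and GY: "G Y \<in> carrier_mat e' e'"
    using F G X Y unfolding linear_map_def by auto
  show ?thesis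
  proof (rule eq_matI)
    fix r c assume "r < dim_row (kron (F X) (G Y))" "c < dim_col (kron (F X) (G Y))"
    then have r: "r < d' * e'" and c: "c < d' * e'" using FX GY by (auto simp: kron_def)
    note rd = div_mod_less[OF r] div_mod_less[OF c]
    have idx: "i * e + k < d * e" if "i < d" "k < e" for i k
    proof -
      have "i * e + k < Suc i * e" using that by simp
      also have "\<dots> \<le> d * e" using that by (intro mult_right_mono) auto
      finally show ?thesis .
    qed
    have "tensor_map d d' e e' F G (kron X Y) $$ (r, c) =
      (\<Sum>i<d. \<Sum>j<d. \<Sum>k<e. \<Sum>l<e. (X $$ (i, j) * F (mat_unit d i j) $$ (r div e', c div e'))
         * (Y $$ (k, l) * G (mat_unit e k l) $$ (r mod e', c mod e')))"
      unfolding tensor_map_def using r c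
    proof (simp, intro sum.cong refl, goal_cases)
      case (1 i j k l)
      then show ?case
        using X Y idx[of i k] idx[of j l] carrier_matD[OF FE] carrier_matD[OF GE]
        by (simp add: kron_def)
    qed
    also have "\<dots> = (\<Sum>i<d. \<Sum>j<d. X $$ (i, j) * F (mat_unit d i j) $$ (r div e', c div e'))
        * (\<Sum>k<e. \<Sum>l<e. Y $$ (k, l) * G (mat_unit e k l) $$ (r mod e', c mod e'))"
      by (simp only: sum_distrib_right) (simp only: sum_distrib_left)
    also have "\<dots> = kron (F X) (G Y) $$ (r, c)"
      using r c rd FX GY linear_map_entry[OF F X rd(1) rd(3)] linear_map_entry[OF G Y rd(2) rd(4)]
      by (simp add: kron_def)
    finally show "tensor_map d d' e e' F G (kron X Y) $$ (r, c) = kron (F X) (G Y) $$ (r, c)" .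
  qed (use FX GY in \<open>auto simp: tensor_map_def kron_def\<close>)
qed

end

(*
  Both quantities already see the SWAP gate on product basis states.  Signalling: for input |i>|0>
  the gate outputs |i> at B', whereas Tr_A (x) C outputs a state independent of i; some i has
  probability at most 1/d_A there, so the distance is at least 2 - 2/d_A.  Causal influence: T(S)
  exchanges A with B', so it moves the state |1> of B' away, whereas C (x) I leaves it there; the
  two outputs are orthogonal and the distance is 2.  The tensor powers replace d_A by d_A^n.
  The trace norm is computed from spectral decompositions: it is at most 2 on differences of states,
  and at least twice any diagonal entry of a traceless Hermitian operator.
*)
theory Submission
  imports Defs
begin

section \<open>Spectral theory\<close>

text \<open>The suprema and the infimum in the definitions are real valued, so they carry
  information only for nonempty bounded sets. The bounds therefore rest on side facts: states exist,
  channels exist, and each trace norm under the supremum is at most 2. The last fact comes from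
  writing the image of every extended state as a difference of two states. Complete positivity
  yields states only for maps id \<otimes> C with C on the last factor, whereas Tr_A \<otimes> C and
  C \<otimes> I place it next to another factor; both are rewritten as id \<otimes> C with a larger
  bystander system, combined with a partial trace or a reordering of factors. The operator
  \<open>sqrt_op\<close> is a definite description, so no trace norm can be evaluated before
  positive square roots are known to be unique; existence and uniqueness both go through real
  eigenvalues of Hermitian operators. The SWAP gate, its inverse, its tensor powers and T(S) only
  relabel matrix entries. Identities between them thus become exchanges of digits in mixed radix
  indices.\<close>

lemma sum_index_product:
  fixes g :: "nat \<Rightarrow> 'a::comm_monoid_add"
  shows "(\<Sum>r<m * n. g r) = (\<Sum>i<m. \<Sum>j<n. g (i * n + j))"
proof -
  have "(\<Sum>j<n. g (i * n + j)) = sum g {i * n..<i * n + n}" for i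
    using sum.atLeastLessThan_shift_0[of g "i * n" "i * n + n"] by (simp add: lessThan_atLeast0 comp_def)
  then show ?thesis by (simp only: sum.nat_group)
qed

subsection \<open>Inner products and orthonormal systems\<close>

text \<open>Vectors are plain functions of which only the values below \<open>n\<close> count, so
  sums and multiples need no carrier conditions. The form is linear in the first argument.\<close>

definition ip :: "nat \<Rightarrow> (nat \<Rightarrow> complex) \<Rightarrow> (nat \<Rightarrow> complex) \<Rightarrow> complex" where
  "ip n x y = (\<Sum>j<n. x j * cnj (y j))"

definition orthonormal :: "nat \<Rightarrow> nat \<Rightarrow> (nat \<Rightarrow> nat \<Rightarrow> complex) \<Rightarrow> bool" where
  "orthonormal n k u \<longleftrightarrow> (\<forall>i<k. \<forall>j<k. ip n (u i) (u j) = (if i = j then 1 else 0))"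

lemma cnj_ip: "cnj (ip n x y) = ip n y x"
  unfolding ip_def by (simp add: mult.commute)

lemma ip_diff_left: "ip n (\<lambda>j. x j - y j) z = ip n x z - ip n y z"
  unfolding ip_def by (simp add: left_diff_distrib sum_subtractf)

lemma ip_diff_right: "ip n z (\<lambda>j. x j - y j) = ip n z x - ip n z y"
  unfolding ip_def by (simp add: right_diff_distrib sum_subtractf)

lemma ip_smult_left: "ip n (\<lambda>j. c * x j) z = c * ip n x z"
  unfolding ip_def by (simp add: sum_distrib_left mult.assoc)

lemma ip_smult_right: "ip n z (\<lambda>j. c * x j) = cnj c * ip n z x"
  unfolding ip_def by (simp add: sum_distrib_left mult.left_commute)

lemma ip_sum_left: "ip n (\<lambda>j. \<Sum>i\<in>I. c i * u i j) z = (\<Sum>i\<in>I. c i * ip n (u i) z)"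
  unfolding ip_def sum_distrib_left sum_distrib_right by (subst sum.swap) (simp add: mult.assoc)

lemma ip_sum_right: "ip n z (\<lambda>j. \<Sum>i\<in>I. c i * u i j) = (\<Sum>i\<in>I. cnj (c i) * ip n z (u i))"
proof -
  have "ip n z (\<lambda>j. \<Sum>i\<in>I. c i * u i j) = cnj (\<Sum>i\<in>I. c i * ip n (u i) z)"
    unfolding ip_sum_left[symmetric] cnj_ip ..
  then show ?thesis by (simp add: cnj_ip)
qed

lemma ip_cong: "(\<And>j. j < n \<Longrightarrow> x j = x' j) \<Longrightarrow> (\<And>j. j < n \<Longrightarrow> y j = y' j) \<Longrightarrow> ip n x y = ip n x' y'"
  unfolding ip_def by (intro sum.cong) auto

lemma ip_self: "ip n x x = of_real (\<Sum>j<n. (cmod (x j))\<^sup>2)"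
  unfolding ip_def of_real_sum complex_norm_square ..

text \<open>With \<open>y\<close> the orthogonal projection of \<open>x\<close> onto the span of the
  system, the products of \<open>x\<close> with \<open>y\<close>, of \<open>y\<close> with
  \<open>x\<close> and of \<open>y\<close> with itself all equal the left-hand side, so the squared
  norm of \<open>x - y\<close> is the difference of the two sides.\<close>

lemma bessel:
  assumes "orthonormal n k u"
  shows "(\<Sum>i<k. (cmod (ip n x (u i)))\<^sup>2) \<le> (\<Sum>j<n. (cmod (x j))\<^sup>2)"
proof -
  define c where "c i = ip n x (u i)" for i
  define y where "y j = (\<Sum>i<k. c i * u i j)" for j
  have xy: "ip n x y = (\<Sum>i<k. cnj (c i) * c i)"
    unfolding y_def ip_sum_right c_def ..
  have uy: "ip n (u i) y = cnj (c i)" if "i < k" for i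
  proof -
    have "ip n (u i) y = (\<Sum>i'<k. cnj (c i') * (if i = i' then 1 else 0))"
      unfolding y_def ip_sum_right using assms that
      by (intro sum.cong) (auto simp: orthonormal_def)
    also have "\<dots> = cnj (c i)" using that by (simp add: if_distrib cong: if_cong)
    finally show ?thesis .
  qed
  have yy: "ip n y y = (\<Sum>i<k. c i * cnj (c i))"
    by (subst (1) y_def[abs_def], subst ip_sum_left) (auto intro!: sum.cong simp: uy)
  have yx: "ip n y x = (\<Sum>i<k. c i * cnj (c i))"
    using arg_cong[OF xy, of cnj] by (simp add: cnj_ip)
  have "ip n (\<lambda>j. x j - y j) (\<lambda>j. x j - y j) = ip n x x - (\<Sum>i<k. c i * cnj (c i))"
    by (simp add: ip_diff_left ip_diff_right xy yy yx mult.commute)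
  also have "\<dots> = of_real ((\<Sum>j<n. (cmod (x j))\<^sup>2) - (\<Sum>i<k. (cmod (c i))\<^sup>2))"
    unfolding ip_self of_real_diff of_real_sum complex_norm_square ..
  finally have "(\<Sum>j<n. (cmod (x j - y j))\<^sup>2) = (\<Sum>j<n. (cmod (x j))\<^sup>2) - (\<Sum>i<k. (cmod (c i))\<^sup>2)"
    unfolding ip_self of_real_eq_iff .
  moreover have "0 \<le> (\<Sum>j<n. (cmod (x j - y j))\<^sup>2)" by (intro sum_nonneg) auto
  ultimately show ?thesis by (simp add: c_def)
qed

lemma orthonormal_norm:
  assumes "orthonormal n k u" "i < k" shows "(\<Sum>j<n. (cmod (u i j))\<^sup>2) = 1"
proof -
  have "ip n (u i) (u i) = 1" using assms unfolding orthonormal_def by auto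
  then show ?thesis unfolding ip_self using of_real_eq_1_iff by blast
qed

lemma orthonormal_entry_sum:
  assumes "orthonormal n k u" "j < n" shows "(\<Sum>i<k. (cmod (u i j))\<^sup>2) \<le> 1"
proof -
  define e :: "nat \<Rightarrow> complex" where "e l = (if l = j then 1 else 0)" for l
  have "ip n e (u i) = cnj (u i j)" for i
    using assms(2) unfolding ip_def e_def by (simp add: if_distribR if_distrib cong: if_cong)
  moreover have "(\<Sum>l<n. (cmod (e l))\<^sup>2) = 1"
    using assms(2) unfolding e_def by (simp add: if_distribR if_distrib cong: if_cong)
  ultimately show ?thesis using bessel[OF assms(1), of e] by simp
qed

text \<open>Double counting of the squared moduli in the table of entries: every vector contributes
  1, every coordinate at most 1.\<close>

lemma orthonormal_card: 
  assumes "orthonormal n k u" shows "k \<le> n"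
proof -
  have "real k = (\<Sum>i<k. \<Sum>j<n. (cmod (u i j))\<^sup>2)"
    using orthonormal_norm[OF assms] by simp
  also have "\<dots> = (\<Sum>j<n. \<Sum>i<k. (cmod (u i j))\<^sup>2)" by (rule sum.swap)
  also have "\<dots> \<le> (\<Sum>j<n. 1)" by (intro sum_mono orthonormal_entry_sum[OF assms]) auto
  finally show ?thesis by simp
qed

subsection \<open>Hermitian operators\<close>

definition hermitian :: "nat \<Rightarrow> cmat \<Rightarrow> bool" where
  "hermitian n A \<longleftrightarrow> A \<in> carrier_mat n n \<and> (\<forall>r<n. \<forall>c<n. A $$ (c, r) = cnj (A $$ (r, c)))"

definition mapply :: "nat \<Rightarrow> cmat \<Rightarrow> (nat \<Rightarrow> complex) \<Rightarrow> nat \<Rightarrow> complex" where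
  "mapply n A x r = (\<Sum>c<n. A $$ (r, c) * x c)"

lemma mapply_hermitian:
  assumes "hermitian n A" shows "ip n (mapply n A x) y = ip n x (mapply n A y)"
proof -
  have "ip n (mapply n A x) y = (\<Sum>r<n. \<Sum>c<n. A $$ (r, c) * x c * cnj (y r))"
    unfolding ip_def mapply_def by (simp add: sum_distrib_right)
  also have "\<dots> = (\<Sum>c<n. \<Sum>r<n. A $$ (r, c) * x c * cnj (y r))" by (rule sum.swap)
  also have "\<dots> = ip n x (mapply n A y)"
    unfolding ip_def mapply_def cnj_sum sum_distrib_left
  proof (intro sum.cong refl)
    fix c r assume "c \<in> {..<n}" "r \<in> {..<n}"
    then have "A $$ (r, c) = cnj (A $$ (c, r))" using assms unfolding hermitian_def by blast
    then show "A $$ (r, c) * x c * cnj (y r) = x c * cnj (A $$ (c, r) * y r)" by simp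
  qed
  finally show ?thesis .
qed

text \<open>Cyclicity of the trace (\<open>comm\<close>). This transports the trace of
  \<open>A * A\<close> to a triangular form, where it can be read off the eigenvalues.\<close>

lemma trace_similar:
  assumes "similar_mat_wit A B P Q" shows "trace A = trace B"
proof -
  obtain n where n: "n = dim_row A" by simp
  note w = similar_mat_witD[OF n assms]
  have comm: "trace (X * Y) = trace (Y * X)" if "X \<in> carrier_mat n n" "Y \<in> carrier_mat n n" for X Y :: cmat
  proof -
    have "trace (X * Y) = (\<Sum>i<n. \<Sum>j<n. X $$ (i, j) * Y $$ (j, i))"
      using that by (auto simp: trace_def scalar_prod_def lessThan_atLeast0 intro!: sum.cong)
    also have "\<dots> = (\<Sum>j<n. \<Sum>i<n. Y $$ (j, i) * X $$ (i, j))"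
      by (subst sum.swap) (simp add: mult.commute)
    also have "\<dots> = trace (Y * X)"
      using that by (auto simp: trace_def scalar_prod_def lessThan_atLeast0 intro!: sum.cong)
    finally show ?thesis .
  qed
  have "trace A = trace (P * (B * Q))" using w by (simp add: assoc_mult_mat[of P n n B n Q n])
  also have "\<dots> = trace ((B * Q) * P)" using w by (intro comm) auto
  also have "(B * Q) * P = B" using w by (simp add: assoc_mult_mat[of B n n Q n P n])
  finally show ?thesis .
qed

text \<open>If all eigenvalues of \<open>A\<close> were zero, then so would be the trace of \<open>A\<^sup>2\<close>, which is the
  sum of the squared moduli of the entries of \<open>A\<close>.\<close>

lemma hermitian_nonzero_eigenvalue:
  assumes A: "hermitian n A" and nz: "r0 < n" "c0 < n" "A $$ (r0, c0) \<noteq> 0"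
  shows "\<exists>(\<mu>::real) w. \<mu> \<noteq> 0 \<and> ip n w w = 1 \<and> (\<forall>r<n. mapply n A w r = \<mu> * w r)"
proof -
  have Ac: "A \<in> carrier_mat n n" using A unfolding hermitian_def by simp
  obtain es where es: "char_poly A = (\<Prod>e\<leftarrow>es. [:- e, 1:])"
    using char_poly_factorized[OF Ac] by blast
  obtain B P Q where BPQ: "schur_decomposition A es = (B, P, Q)" by (cases "schur_decomposition A es")
  have sim: "similar_mat_wit A B P Q" and ut: "upper_triangular B" and dg: "diag_mat B = es"
    using schur_decomposition[OF Ac es BPQ] by auto
  note w = similar_mat_witD2[OF Ac sim]
  have "similar_mat_wit (A ^\<^sub>m 2) (B ^\<^sub>m 2) P Q" by (rule similar_mat_wit_pow[OF sim])
  then have tr: "trace (A * A) = trace (B * B)" using trace_similar w(4,5) by (simp add: numeral_2_eq_2)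
  have "trace (A * A) = (\<Sum>i<n. \<Sum>j<n. A $$ (i, j) * A $$ (j, i))"
    using Ac by (auto simp: trace_def scalar_prod_def lessThan_atLeast0 intro!: sum.cong)
  also have "\<dots> = of_real (\<Sum>i<n. \<Sum>j<n. (cmod (A $$ (i, j)))\<^sup>2)"
    unfolding of_real_sum complex_norm_square
  proof (intro sum.cong refl)
    fix i j assume "i \<in> {..<n}" "j \<in> {..<n}"
    then have "A $$ (j, i) = cnj (A $$ (i, j))" using A unfolding hermitian_def by blast
    then show "A $$ (i, j) * A $$ (j, i) = A $$ (i, j) * cnj (A $$ (i, j))" by simp
  qed
  finally have trA: "trace (A * A) = of_real (\<Sum>i<n. \<Sum>j<n. (cmod (A $$ (i, j)))\<^sup>2)" .
  have "(\<Sum>i<n. \<Sum>j<n. (cmod (A $$ (i, j)))\<^sup>2) \<noteq> 0"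
    using nz by (auto simp: sum_nonneg_eq_0_iff sum_nonneg)
  then have "trace (B * B) \<noteq> 0" unfolding tr[symmetric] trA of_real_eq_0_iff .
  moreover have "trace (B * B) = (\<Sum>i<n. B $$ (i, i) * B $$ (i, i))"
  proof -
    have "trace (B * B) = (\<Sum>i<n. \<Sum>j<n. B $$ (i, j) * B $$ (j, i))"
      using w(5) by (auto simp: trace_def scalar_prod_def lessThan_atLeast0 intro!: sum.cong)
    \<comment> \<open>For \<open>i \<noteq> j\<close> one of the two factors lies below the diagonal
      of the triangular matrix \<open>B\<close> and vanishes.\<close>
    also have "\<dots> = (\<Sum>i<n. \<Sum>j<n. if j = i then B $$ (i, i) * B $$ (i, i) else 0)"
    proof (intro sum.cong refl)
      fix i j assume "i \<in> {..<n}" "j \<in> {..<n}"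
      then show "B $$ (i, j) * B $$ (j, i) = (if j = i then B $$ (i, i) * B $$ (i, i) else 0)"
        using ut w(5) unfolding upper_triangular_def by (cases i j rule: linorder_cases) auto
    qed
    finally show ?thesis by simp
  qed
  ultimately obtain i where i: "i < n" "B $$ (i, i) \<noteq> 0"
    by (metis (no_types, lifting) lessThan_iff mult_zero_left sum.neutral)
  define \<mu> where "\<mu> = B $$ (i, i)"
  have "\<mu> \<in> set es" using dg i(1) w(5) unfolding \<mu>_def diag_mat_def by auto
  then have "poly (char_poly A) \<mu> = 0" unfolding es by (auto simp: poly_prod_list prod_list_zero_iff)
  then obtain v where v: "v \<in> carrier_vec n" "v \<noteq> 0\<^sub>v n" "A *\<^sub>v v = \<mu> \<cdot>\<^sub>v v"
    using eigenvalue_root_char_poly[OF Ac] Ac unfolding eigenvalue_def eigenvector_def by auto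
  have Av: "mapply n A (($) v) r = \<mu> * v $ r" if "r < n" for r
  proof -
    have "(A *\<^sub>v v) $ r = mapply n A (($) v) r"
      using v(1) Ac that by (simp add: mapply_def scalar_prod_def lessThan_atLeast0)
    then show ?thesis using v that by simp
  qed
  obtain j where j: "j < n" "v $ j \<noteq> 0" using v(1,2) by (metis carrier_vecD eq_vecI index_zero_vec)
  define s where "s = (\<Sum>j<n. (cmod (v $ j))\<^sup>2)"
  have ss: "ip n (($) v) (($) v) = of_real s" unfolding ip_self s_def ..
  have s: "s > 0" using j unfolding s_def by (intro sum_pos2[of _ j]) auto
  \<comment> \<open>Moving \<open>A\<close> to the other side of the inner product replaces the
    eigenvalue by its conjugate; as \<open>v\<close> has positive length, the eigenvalue is
    real.\<close>
  have "\<mu> * of_real s = ip n (mapply n A (($) v)) (($) v)"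
    unfolding ss[symmetric] by (subst ip_smult_left[symmetric]) (auto intro!: ip_cong simp: Av)
  also have "\<dots> = cnj \<mu> * of_real s"
    unfolding mapply_hermitian[OF A] ss[symmetric]
    by (subst ip_smult_right[symmetric]) (auto intro!: ip_cong simp: Av)
  finally have "cnj \<mu> = \<mu>" using s by simp
  then have re: "\<mu> = of_real (Re \<mu>)" by (metis complex_is_Real_iff Reals_cnj_iff of_real_Re)
  define w where "w j = of_real (1 / sqrt s) * v $ j" for j
  have "ip n w w = 1"
    using s unfolding w_def ip_smult_left ip_smult_right ss
    by (simp flip: of_real_mult add: field_simps)
  moreover have "mapply n A w r = Re \<mu> * w r" if "r < n" for r
  proof -
    have "mapply n A w r = of_real (1 / sqrt s) * mapply n A (($) v) r"
      unfolding mapply_def w_def sum_distrib_left by (simp add: mult.left_commute)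
    then show ?thesis using Av[OF that] re by (simp add: w_def mult.left_commute)
  qed
  moreover have "Re \<mu> \<noteq> 0" using re i(2) unfolding \<mu>_def by (metis of_real_0)
  ultimately show ?thesis by blast
qed

section \<open>Spectral decompositions of Hermitian operators\<close>

lemma ip_mapply_spectral:
  assumes "\<And>r c. r < n \<Longrightarrow> c < n \<Longrightarrow> A $$ (r, c) = (\<Sum>i<k. lam i * u i r * cnj (u i c))" "r < n"
  shows "mapply n A x r = (\<Sum>i<k. lam i * ip n x (u i) * u i r)"
proof -
  have "mapply n A x r = (\<Sum>c<n. \<Sum>i<k. lam i * u i r * cnj (u i c) * x c)"
    unfolding mapply_def using assms by (intro sum.cong refl) (simp add: sum_distrib_right)
  also have "\<dots> = (\<Sum>i<k. \<Sum>c<n. lam i * u i r * cnj (u i c) * x c)" by (rule sum.swap)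
  also have "\<dots> = (\<Sum>i<k. lam i * ip n x (u i) * u i r)"
    unfolding ip_def sum_distrib_left sum_distrib_right by (simp add: mult_ac)
  finally show ?thesis .
qed

text \<open>The system need not be a basis: the complement of its span lies in the kernel of
  \<open>A\<close>, which contributes nothing to the trace or to the trace norm.\<close>

definition spectral ::
  "nat \<Rightarrow> nat \<Rightarrow> (nat \<Rightarrow> real) \<Rightarrow> (nat \<Rightarrow> nat \<Rightarrow> complex) \<Rightarrow> cmat \<Rightarrow> bool" where
  "spectral n k lam u A \<longleftrightarrow> A \<in> carrier_mat n n \<and> orthonormal n k u \<and>
     (\<forall>r<n. \<forall>c<n. A $$ (r, c) = (\<Sum>i<k. of_real (lam i) * u i r * cnj (u i c)))"

text \<open>Take an orthonormal system of eigenvectors for nonzero eigenvalues that is as long as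
  possible; by Bessel's inequality the length is at most \<open>n\<close>.  If subtracting the corresponding
  part of \<open>A\<close> left something nonzero, a further eigenvector could be added.\<close>

theorem hermitian_spectral:
  assumes A: "hermitian n A"
  shows "\<exists>k lam u. spectral n k lam u A"
proof -
  define E where "E k lam u \<longleftrightarrow> orthonormal n k u \<and>
     (\<forall>i<k. \<forall>r<n. mapply n A (u i) r = of_real (lam i) * u i r)" for k u and lam :: "nat \<Rightarrow> real"
  define K where "K k \<longleftrightarrow> (\<exists>lam u. E k lam u)" for k
  have K0: "K 0" unfolding K_def E_def orthonormal_def by simp
  have Kb: "\<And>k. K k \<Longrightarrow> k \<le> n" unfolding K_def E_def using orthonormal_card by blast
  define k where "k = Greatest K"
  have Kk: "K k" unfolding k_def by (rule GreatestI_nat[of K 0 n]) (use K0 Kb in auto)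
  have kmax: "\<not> K (Suc k)"
    using Greatest_le_nat[of K "Suc k" n] Kb unfolding k_def by auto
  obtain lam u where on: "orthonormal n k u"
    and ev: "\<And>i r. i < k \<Longrightarrow> r < n \<Longrightarrow> mapply n A (u i) r = of_real (lam i) * u i r"
    using Kk unfolding K_def E_def by blast
  define S where "S = mat n n (\<lambda>(r, c). \<Sum>i<k. of_real (lam i) * u i r * cnj (u i c))"
  define B where "B = A - S"
  have Ac: "A \<in> carrier_mat n n" using A unfolding hermitian_def by simp
  have Bh: "hermitian n B" unfolding hermitian_def
  proof (intro conjI allI impI)
    show "B \<in> carrier_mat n n" using Ac by (simp add: B_def S_def minus_mat_def)
    fix r c assume rc: "r < n" "c < n"
    then have "A $$ (c, r) = cnj (A $$ (r, c))" using A unfolding hermitian_def by blast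
    moreover have "S $$ (c, r) = cnj (S $$ (r, c))" using rc by (simp add: S_def mult_ac)
    moreover have "B $$ (c, r) = A $$ (c, r) - S $$ (c, r)" "B $$ (r, c) = A $$ (r, c) - S $$ (r, c)"
      using rc Ac by (simp_all add: B_def S_def)
    ultimately show "B $$ (c, r) = cnj (B $$ (r, c))" by (simp only: complex_cnj_diff)
  qed
  have mS: "mapply n S x r = (\<Sum>i<k. of_real (lam i) * ip n x (u i) * u i r)" if "r < n" for x r
    by (rule ip_mapply_spectral) (use that in \<open>auto simp: S_def\<close>)
  have mB: "mapply n B x r = mapply n A x r - mapply n S x r" if "r < n" for x r
    using that Ac unfolding mapply_def B_def
    by (simp add: S_def left_diff_distrib sum_subtractf)
  have "B $$ (r, c) = 0" if rc: "r < n" "c < n" for r c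
  proof (rule ccontr)
    assume "B $$ (r, c) \<noteq> 0"
    then obtain \<mu> :: real and w :: "nat \<Rightarrow> complex" where mu: "\<mu> \<noteq> 0" "ip n w w = 1"
      "\<And>r. r < n \<Longrightarrow> mapply n B w r = \<mu> * w r"
      using hermitian_nonzero_eigenvalue[OF Bh rc] by blast
    have Bu: "mapply n B (u i) r = 0" if "i < k" "r < n" for i r
    proof -
      have "mapply n S (u i) r = (\<Sum>i'<k. if i' = i then of_real (lam i) * u i r else 0)"
        unfolding mS[OF that(2)] using on that by (intro sum.cong) (auto simp: orthonormal_def)
      also have "\<dots> = of_real (lam i) * u i r" using that by simp
      finally show ?thesis using mB ev that by simp
    qed
    \<comment> \<open>Eigenvectors of the Hermitian \<open>B\<close> for the distinct eigenvalues
      \<mu> \<noteq> 0 and 0 are orthogonal.\<close>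
    have wu: "ip n w (u i) = 0" if "i < k" for i
    proof -
      have "\<mu> * ip n w (u i) = ip n (mapply n B w) (u i)"
        by (subst ip_smult_left[symmetric]) (auto intro!: ip_cong simp: mu)
      also have "\<dots> = ip n w (mapply n B (u i))" by (rule mapply_hermitian[OF Bh])
      also have "\<dots> = 0" unfolding ip_def using Bu[OF that] by simp
      finally show ?thesis using mu(1) by simp
    qed
    have uw: "ip n (u i) w = 0" if "i < k" for i
      using arg_cong[OF wu[OF that], of cnj] by (simp add: cnj_ip)
    \<comment> \<open>The subtracted part \<open>S\<close> kills everything orthogonal to the
      \<open>u i\<close>, so \<open>w\<close> is an eigenvector of \<open>A\<close> itself and
      prolongs the maximal system.\<close>
    have Aw: "mapply n A w r = \<mu> * w r" if "r < n" for r
      using mu(3)[OF that] mB[OF that, of w] mS[OF that, of w] wu by simp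
    have "E (Suc k) (lam(k := \<mu>)) (u(k := w))"
      unfolding E_def orthonormal_def
    proof (intro conjI allI impI)
      fix i j assume "i < Suc k" "j < Suc k"
      then show "ip n ((u(k := w)) i) ((u(k := w)) j) = (if i = j then 1 else 0)"
        using on mu(2) wu uw unfolding orthonormal_def by (auto simp: less_Suc_eq)
    next
      fix i r assume "i < Suc k" "r < n"
      then show "mapply n A ((u(k := w)) i) r = of_real ((lam(k := \<mu>)) i) * (u(k := w)) i r"
        using ev Aw by (auto simp: less_Suc_eq)
    qed
    then show False using kmax unfolding K_def by blast
  qed
  then have "A $$ (r, c) = (\<Sum>i<k. of_real (lam i) * u i r * cnj (u i c))" if "r < n" "c < n" for r c
    using that Ac by (fastforce simp: B_def S_def)
  then show ?thesis using on Ac unfolding spectral_def by blast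
qed

lemma spectral_quadratic_form:
  assumes "spectral n k lam u A"
  shows "ip n (mapply n A x) x = of_real (\<Sum>i<k. lam i * (cmod (ip n x (u i)))\<^sup>2)"
proof -
  have "ip n (mapply n A x) x = ip n (\<lambda>r. \<Sum>i<k. (of_real (lam i) * ip n x (u i)) * u i r) x"
    using assms unfolding spectral_def by (intro ip_cong ip_mapply_spectral) auto
  also have "\<dots> = (\<Sum>i<k. of_real (lam i) * ip n x (u i) * cnj (ip n x (u i)))"
    unfolding ip_sum_left cnj_ip ..
  also have "\<dots> = (\<Sum>i<k. of_real (lam i * (cmod (ip n x (u i)))\<^sup>2))"
    unfolding of_real_mult complex_norm_square mult.assoc ..
  finally show ?thesis by simp
qed

lemma spectral_eigenvector:
  assumes "spectral n k lam u A" "i < k" "r < n"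
  shows "mapply n A (u i) r = of_real (lam i) * u i r"
proof -
  have "mapply n A (u i) r = (\<Sum>i'<k. of_real (lam i') * ip n (u i) (u i') * u i' r)"
    using assms unfolding spectral_def by (intro ip_mapply_spectral) auto
  also have "\<dots> = (\<Sum>i'<k. if i' = i then of_real (lam i) * u i r else 0)"
    using assms unfolding spectral_def by (intro sum.cong) (auto simp: orthonormal_def)
  also have "\<dots> = of_real (lam i) * u i r" using assms by simp
  finally show ?thesis .
qed

lemma spectral_trace:
  assumes "spectral n k lam u A"
  shows "trace A = of_real (\<Sum>i<k. lam i)"
proof -
  have "trace A = (\<Sum>r<n. \<Sum>i<k. of_real (lam i) * u i r * cnj (u i r))"
    using assms unfolding spectral_def trace_def by auto
  also have "\<dots> = (\<Sum>i<k. of_real (lam i) * ip n (u i) (u i))"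
    unfolding ip_def sum_distrib_left by (subst sum.swap) (simp add: mult.assoc)
  also have "\<dots> = (\<Sum>i<k. of_real (lam i))"
    using assms unfolding spectral_def by (intro sum.cong) (auto simp: orthonormal_def)
  finally show ?thesis by simp
qed

text \<open>Only squares of eigenvalues enter, so signs can be changed without altering the square;
  this identifies a root of X^2 with nonnegative eigenvalues.\<close>

lemma spectral_square:
  assumes A: "spectral n k lam u A" and rc: "r < n" "c < n"
  shows "(A * A) $$ (r, c) = (\<Sum>i<k. of_real ((lam i)\<^sup>2) * u i r * cnj (u i c))"
proof -
  have "(A * A) $$ (r, c) = mapply n A (\<lambda>s. A $$ (s, c)) r"
    using A rc unfolding spectral_def
    by (auto simp: mapply_def scalar_prod_def lessThan_atLeast0)
  also have "\<dots> = mapply n A (\<lambda>s. \<Sum>i<k. (of_real (lam i) * cnj (u i c)) * u i s) r"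
    unfolding mapply_def using A rc unfolding spectral_def by (intro sum.cong) (auto simp: mult_ac)
  also have "\<dots> = (\<Sum>i<k. (of_real (lam i) * cnj (u i c)) * mapply n A (u i) r)"
    unfolding mapply_def sum_distrib_left by (subst sum.swap) (simp add: mult_ac)
  also have "\<dots> = (\<Sum>i<k. of_real ((lam i)\<^sup>2) * u i r * cnj (u i c))"
    using spectral_eigenvector[OF A _ rc(1)]
    by (intro sum.cong) (auto simp: power2_eq_square mult_ac)
  finally show ?thesis .
qed

subsection \<open>Positive operators and their square roots\<close>

lemma positive_op_iff:
  "positive_op n A \<longleftrightarrow> A \<in> carrier_mat n n \<and> (\<forall>x. 0 \<le> ip n (mapply n A x) x)"
proof -
  have eq: "(A *\<^sub>v v) \<bullet>c v = ip n (mapply n A (($) v)) (($) v)"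
    if "A \<in> carrier_mat n n" "v \<in> carrier_vec n" for v
    using that by (auto simp: ip_def mapply_def scalar_prod_def lessThan_atLeast0 intro!: sum.cong)
  have "ip n (mapply n A x) x = ip n (mapply n A (($) (vec n x))) (($) (vec n x))" for x
    by (auto intro!: ip_cong sum.cong simp: mapply_def)
  then show ?thesis unfolding positive_op_def using eq by (metis vec_carrier)
qed

lemma positive_op_spectral:
  assumes "spectral n k lam u A" "\<And>i. i < k \<Longrightarrow> 0 \<le> lam i"
  shows "positive_op n A"
proof -
  have "0 \<le> ip n (mapply n A x) x" for x
    unfolding spectral_quadratic_form[OF assms(1)]
    using assms(2) by (auto simp: less_eq_complex_def intro!: sum_nonneg)
  then show ?thesis using assms(1) unfolding positive_op_iff spectral_def by blast
qed

text \<open>Evaluate the quadratic form at \<open>e\<^sub>r + t e\<^sub>c\<close> for \<open>t = 1\<close> and \<open>t = \<i>\<close>.\<close>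

lemma positive_op_hermitian:
  assumes A: "positive_op n A" shows "hermitian n A"
  unfolding hermitian_def
proof (intro conjI allI impI)
  show "A \<in> carrier_mat n n" using A unfolding positive_op_iff by simp
  fix r c assume rc: "r < n" "c < n"
  have q: "Im (A $$ (r, r) + t * A $$ (r, c) + cnj t * A $$ (c, r) + t * cnj t * A $$ (c, c)) = 0" for t
  proof -
    \<comment> \<open>The two indicators are added instead of being joined in one case distinction,
      so that \<open>r = c\<close> is covered as well.\<close>
    define x where "x j = (if j = r then 1 else 0) + (if j = c then t else 0)" for j
    have pick: "(\<Sum>j<n. f j * (if j = b then z else 0)) = f b * z" if "b < n"
      for b z and f :: "nat \<Rightarrow> complex"
      using that by (simp add: if_distrib cong: if_cong)
    have "mapply n A x s = A $$ (s, r) + A $$ (s, c) * t" for s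
      using rc unfolding mapply_def x_def distrib_left sum.distrib by (simp only: pick mult_1_right)
    then have "ip n (mapply n A x) x
        = (A $$ (r, r) + A $$ (r, c) * t) + (A $$ (c, r) + A $$ (c, c) * t) * cnj t"
      using rc unfolding ip_def x_def complex_cnj_add if_distrib[of cnj] complex_cnj_zero complex_cnj_one
        distrib_left sum.distrib by (simp only: pick mult_1_right)
    moreover have "Im (ip n (mapply n A x) x) = 0"
      using A unfolding positive_op_iff less_eq_complex_def by (metis zero_complex.simps(2))
    ultimately show ?thesis by (simp add: algebra_simps)
  qed
  have "Im (A $$ (r, r)) = 0" using q[of 0] by simp
  \<comment> \<open>Adding the identities for \<open>t = 1\<close> and \<open>t = -1\<close> cancels
    the off-diagonal terms.\<close>
  moreover have "Im (A $$ (c, c)) = 0" using q[of 1] q[of "-1"] calculation by simp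
  ultimately show "A $$ (c, r) = cnj (A $$ (r, c))"
    using q[of 1] q[of \<i>] by (auto simp: complex_eq_iff)
qed

lemma hermitian_minus:
  assumes "hermitian n A" "hermitian n B" shows "hermitian n (A - B)"
  unfolding hermitian_def
proof (intro conjI allI impI)
  show "A - B \<in> carrier_mat n n" using assms unfolding hermitian_def by (auto simp: minus_mat_def)
  fix r c assume rc: "r < n" "c < n"
  then have "A $$ (c, r) = cnj (A $$ (r, c))" "B $$ (c, r) = cnj (B $$ (r, c))"
    using assms unfolding hermitian_def by blast+
  moreover have "(A - B) $$ (c, r) = A $$ (c, r) - B $$ (c, r)"
    "(A - B) $$ (r, c) = A $$ (r, c) - B $$ (r, c)"
    using rc assms unfolding hermitian_def by (metis carrier_matD index_minus_mat(1))+
  ultimately show "(A - B) $$ (c, r) = cnj ((A - B) $$ (r, c))" by (simp only: complex_cnj_diff)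
qed

lemma mapply_diff:
  assumes "A \<in> carrier_mat n n" "B \<in> carrier_mat n n" "r < n"
  shows "mapply n (A - B) x r = mapply n A x r - mapply n B x r"
  using assms unfolding mapply_def by (simp add: left_diff_distrib sum_subtractf)

lemma positive_op_square_norm:
  assumes A: "positive_op n A"
  shows "ip n (mapply n (A * A) x) x = ip n (mapply n A x) (mapply n A x)"
proof -
  have Ac: "A \<in> carrier_mat n n" using A unfolding positive_op_iff by simp
  have "mapply n (A * A) x r = mapply n A (mapply n A x) r" if "r < n" for r
  proof -
    have "mapply n (A * A) x r = (\<Sum>c<n. \<Sum>s<n. A $$ (r, s) * A $$ (s, c) * x c)"
      using Ac that unfolding mapply_def
      by (auto simp: scalar_prod_def lessThan_atLeast0 sum_distrib_right intro!: sum.cong)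
    also have "\<dots> = (\<Sum>s<n. \<Sum>c<n. A $$ (r, s) * A $$ (s, c) * x c)" by (rule sum.swap)
    also have "\<dots> = mapply n A (mapply n A x) r"
      unfolding mapply_def sum_distrib_left by (simp add: mult.assoc)
    finally show ?thesis .
  qed
  then have "ip n (mapply n (A * A) x) x = ip n (mapply n A (mapply n A x)) x" by (intro ip_cong) auto
  then show ?thesis by (simp add: mapply_hermitian[OF positive_op_hermitian[OF A]])
qed

text \<open>If \<open>R w = S w + \<mu> w\<close> with \<open>\<mu> > 0\<close>, then \<open>R w\<close> would be strictly longer than \<open>S w\<close>.\<close>

lemma positive_sqrt_gap:
  assumes R: "positive_op n R" and S: "positive_op n S" and eq: "R * R = S * S"
    and w: "ip n w w = 1" and gap: "\<And>r. r < n \<Longrightarrow> mapply n R w r = mapply n S w r + of_real \<mu> * w r"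
  shows "\<mu> \<le> 0"
proof (rule ccontr)
  assume mu: "\<not> \<mu> \<le> 0"
  define p where "p = Re (ip n (mapply n S w) w)"
  have "0 \<le> ip n (mapply n S w) w" using S unfolding positive_op_iff by blast
  then have p: "ip n (mapply n S w) w = of_real p" "0 \<le> p"
    unfolding p_def by (auto simp: less_eq_complex_def complex_eq_iff)
  have p': "ip n w (mapply n S w) = of_real p"
    using arg_cong[OF p(1), of cnj] by (simp add: cnj_ip)
  have "ip n (mapply n R w) (mapply n R w)
      = ip n (\<lambda>r. mapply n S w r - of_real (- \<mu>) * w r) (\<lambda>r. mapply n S w r - of_real (- \<mu>) * w r)"
    using gap by (intro ip_cong) auto
  also have "\<dots> = ip n (mapply n S w) (mapply n S w) + of_real (2 * \<mu> * p + \<mu>\<^sup>2)"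
    unfolding ip_diff_left ip_diff_right ip_smult_left ip_smult_right p p' w
    by (simp add: algebra_simps power2_eq_square)
  also have "ip n (mapply n S w) (mapply n S w) = ip n (mapply n R w) (mapply n R w)"
    unfolding positive_op_square_norm[OF R, symmetric] positive_op_square_norm[OF S, symmetric] eq ..
  finally have "2 * \<mu> * p + \<mu>\<^sup>2 = 0"
    using of_real_eq_0_iff by (metis add_cancel_left_right)
  moreover have "2 * \<mu> * p + \<mu>\<^sup>2 > 0" using mu p(2) by (intro add_nonneg_pos) auto
  ultimately show False by simp
qed

text \<open>A nonzero Hermitian difference would have a unit eigenvector with a real eigenvalue
  \<mu> \<noteq> 0. The preceding inequality, used for both orders of the two roots, gives \<mu>
  \<le> 0 and -\<mu> \<le> 0.\<close>

lemma positive_sqrt_unique: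
  assumes R: "positive_op n R" and S: "positive_op n S" and eq: "R * R = S * S"
  shows "R = S"
proof (rule ccontr)
  assume "R \<noteq> S"
  have c: "R \<in> carrier_mat n n" "S \<in> carrier_mat n n" using R S unfolding positive_op_iff by auto
  then obtain r0 c0 where rc: "r0 < n" "c0 < n" "R $$ (r0, c0) \<noteq> S $$ (r0, c0)"
    using \<open>R \<noteq> S\<close> by (metis carrier_matD eq_matI)
  have "hermitian n (R - S)" using R S by (intro hermitian_minus positive_op_hermitian)
  moreover have "(R - S) $$ (r0, c0) \<noteq> 0" using rc c by auto
  ultimately obtain \<mu> :: real and w :: "nat \<Rightarrow> complex" where mu: "\<mu> \<noteq> 0" "ip n w w = 1"
    "\<And>r. r < n \<Longrightarrow> mapply n (R - S) w r = \<mu> * w r"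
    using hermitian_nonzero_eigenvalue[of n "R - S" r0 c0] rc(1,2) by blast
  have "mapply n R w r = mapply n S w r + of_real \<mu> * w r"
    "mapply n S w r = mapply n R w r + of_real (- \<mu>) * w r" if "r < n" for r
    using mu(3)[OF that] mapply_diff[OF c that, of w] by (auto simp: algebra_simps)
  then have "\<mu> \<le> 0" "- \<mu> \<le> 0"
    using positive_sqrt_gap[OF R S eq mu(2)] positive_sqrt_gap[OF S R eq[symmetric] mu(2)] by blast+
  then show False using mu(1) by simp
qed

subsection \<open>The trace norm of a Hermitian operator\<close>

text \<open>The operator \<open>R\<close> is the absolute value of \<open>X\<close>: same
  eigenvectors, eigenvalues replaced by their moduli. It is positive with the same square as
  \<open>X\<close>, so by uniqueness it is the root that \<open>sqrt_op\<close> denotes.\<close>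

lemma trace_norm_spectral:
  assumes X: "hermitian n X" and sp: "spectral n k lam u X"
  shows "trace_norm X = (\<Sum>i<k. \<bar>lam i\<bar>)"
proof -
  have Xc: "X \<in> carrier_mat n n" using X unfolding hermitian_def by simp
  have adj: "mat_adjoint X = X"
  proof (rule eq_matI)
    fix r c assume "r < dim_row X" "c < dim_col X"
    then have rc: "r < n" "c < n" using Xc by auto
    then have "X $$ (r, c) = cnj (X $$ (c, r))" using X unfolding hermitian_def by blast
    then show "mat_adjoint X $$ (r, c) = X $$ (r, c)"
      using rc Xc by (simp add: mat_adjoint_def mat_of_rows_index)
  qed (use Xc in \<open>auto simp: mat_adjoint_def\<close>)
  define R where "R = mat n n (\<lambda>(r, c). \<Sum>i<k. of_real \<bar>lam i\<bar> * u i r * cnj (u i c))"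
  have Rc: "R \<in> carrier_mat n n" unfolding R_def by simp
  have spR: "spectral n k (\<lambda>i. \<bar>lam i\<bar>) u R"
    using sp unfolding spectral_def R_def by auto
  have Rp: "positive_op n R" by (rule positive_op_spectral[OF spR]) simp
  have RR: "R * R = X * X"
    using Rc Xc
    by (intro eq_matI) (auto simp: spectral_square[OF spR] spectral_square[OF sp] simp del: index_mult_mat(1))
  have "sqrt_op (X * X) = R" unfolding sqrt_op_def
  proof (rule the_equality)
    show "positive_op (dim_row (X * X)) R \<and> R * R = X * X" using Rp RR Xc by simp
    fix S assume "positive_op (dim_row (X * X)) S \<and> S * S = X * X"
    then show "S = R" using positive_sqrt_unique[OF _ Rp] RR Xc by simp
  qed
  then show ?thesis unfolding trace_norm_def adj using spectral_trace[OF spR] by simp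
qed

lemma norm_ip_commute: "cmod (ip n x y) = cmod (ip n y x)"
  by (metis cnj_ip complex_mod_cnj)

text \<open>Expanding in the eigenvectors \<open>w j\<close> of \<open>P\<close>, each eigenvalue
  \<open>lam j \<ge> 0\<close> gets the weight of \<open>w j\<close> on the system \<open>u\<close>,
  which by Bessel is at most the squared norm 1 of \<open>w j\<close>.\<close>

lemma positive_op_orthonormal_sum:
  assumes P: "positive_op n P" and on: "orthonormal n k u"
  shows "(\<Sum>i<k. Re (ip n (mapply n P (u i)) (u i))) \<le> Re (trace P)"
proof -
  obtain m lam w where sp: "spectral n m lam w P"
    using hermitian_spectral[OF positive_op_hermitian[OF P]] by blast
  have onw: "orthonormal n m w" using sp unfolding spectral_def by simp
  have nn: "0 \<le> lam j" if "j < m" for j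
  proof -
    have "ip n (mapply n P (w j)) (w j) = of_real (lam j) * ip n (w j) (w j)"
      by (subst ip_smult_left[symmetric]) (auto intro!: ip_cong simp: spectral_eigenvector[OF sp that])
    also have "\<dots> = of_real (lam j)" using onw that unfolding orthonormal_def by simp
    finally show ?thesis using P unfolding positive_op_iff by (metis Re_complex_of_real less_eq_complex_def zero_complex.simps(1))
  qed
  have "(\<Sum>i<k. Re (ip n (mapply n P (u i)) (u i)))
      = (\<Sum>i<k. \<Sum>j<m. lam j * (cmod (ip n (u i) (w j)))\<^sup>2)"
    unfolding spectral_quadratic_form[OF sp] by simp
  also have "\<dots> = (\<Sum>j<m. lam j * (\<Sum>i<k. (cmod (ip n (w j) (u i)))\<^sup>2))"
    unfolding sum_distrib_left
    by (subst sum.swap) (simp add: norm_ip_commute)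
  also have "\<dots> \<le> (\<Sum>j<m. lam j * 1)"
    using bessel[OF on] orthonormal_norm[OF onw] nn
    by (intro sum_mono mult_left_mono) (metis lessThan_iff)+
  also have "\<dots> = Re (trace P)" unfolding spectral_trace[OF sp] by simp
  finally show ?thesis .
qed

text \<open>A triangle inequality, tested on the eigenvectors of \<open>P - Q\<close>: each
  eigenvalue is a difference of two nonnegative expectations, hence bounded in modulus by their
  sum.\<close>

lemma trace_norm_diff_le:
  assumes P: "positive_op n P" and Q: "positive_op n Q"
  shows "trace_norm (P - Q) \<le> Re (trace P) + Re (trace Q)"
proof -
  have h: "hermitian n (P - Q)" using P Q by (intro hermitian_minus positive_op_hermitian)
  obtain k lam u where sp: "spectral n k lam u (P - Q)" using hermitian_spectral[OF h] by blast
  have on: "orthonormal n k u" using sp unfolding spectral_def by simp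
  have c: "P \<in> carrier_mat n n" "Q \<in> carrier_mat n n" using P Q unfolding positive_op_iff by auto
  have "\<bar>lam i\<bar> \<le> Re (ip n (mapply n P (u i)) (u i)) + Re (ip n (mapply n Q (u i)) (u i))"
    if "i < k" for i
  proof -
    have "of_real (lam i) = of_real (lam i) * ip n (u i) (u i)"
      using on that unfolding orthonormal_def by simp
    also have "\<dots> = ip n (mapply n (P - Q) (u i)) (u i)"
      by (subst ip_smult_left[symmetric]) (auto intro!: ip_cong simp: spectral_eigenvector[OF sp that])
    also have "\<dots> = ip n (mapply n P (u i)) (u i) - ip n (mapply n Q (u i)) (u i)"
      unfolding ip_diff_left[symmetric] by (intro ip_cong) (auto simp: mapply_diff[OF c])
    finally have "lam i = Re (ip n (mapply n P (u i)) (u i)) - Re (ip n (mapply n Q (u i)) (u i))"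
      by (metis Re_complex_of_real minus_complex.simps(1))
    moreover have "0 \<le> Re (ip n (mapply n P (u i)) (u i))" "0 \<le> Re (ip n (mapply n Q (u i)) (u i))"
      using P Q unfolding positive_op_iff less_eq_complex_def by auto
    ultimately show ?thesis by simp
  qed
  then have "trace_norm (P - Q)
      \<le> (\<Sum>i<k. Re (ip n (mapply n P (u i)) (u i)) + Re (ip n (mapply n Q (u i)) (u i)))"
    unfolding trace_norm_spectral[OF h sp] by (intro sum_mono) auto
  also have "\<dots> \<le> Re (trace P) + Re (trace Q)"
    unfolding sum.distrib by (intro add_mono positive_op_orthonormal_sum on P Q)
  finally show ?thesis .
qed

text \<open>Since \<open>X\<close> is traceless, twice its diagonal entry is its trace against the observable
  \<open>2|j\<rangle>\<langle>j| - 1\<close> of operator norm \<open>1\<close>.\<close>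

lemma trace_norm_ge_diag:
  assumes h: "hermitian n X" and tr: "trace X = 0" and j: "j < n"
  shows "2 * Re (X $$ (j, j)) \<le> trace_norm X"
proof -
  obtain k lam u where sp: "spectral n k lam u X" using hermitian_spectral[OF h] by blast
  have on: "orthonormal n k u" using sp unfolding spectral_def by simp
  define a where "a i = (cmod (u i j))\<^sup>2" for i
  have a: "0 \<le> a i" "a i \<le> 1" if "i < k" for i
  proof -
    show "0 \<le> a i" by (simp add: a_def)
    have "a i \<le> (\<Sum>j<n. (cmod (u i j))\<^sup>2)"
      unfolding a_def using j by (intro member_le_sum) auto
    then show "a i \<le> 1" using orthonormal_norm[OF on that] by simp
  qed
  have "X $$ (j, j) = (\<Sum>i<k. of_real (lam i * a i))"
    using sp j unfolding spectral_def a_def of_real_mult complex_norm_square mult.assoc by blast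
  then have "Re (X $$ (j, j)) = (\<Sum>i<k. lam i * a i)" by simp
  moreover have "(\<Sum>i<k. lam i) = 0" using spectral_trace[OF sp] tr by (metis of_real_eq_0_iff)
  \<comment> \<open>Subtracting the vanishing sum of the eigenvalues shifts the weights
    \<open>2 * a i\<close> from [0, 2] to [-1, 1], which is where the factor 2 is gained.\<close>
  ultimately have "2 * Re (X $$ (j, j)) = (\<Sum>i<k. 2 * (lam i * a i)) - (\<Sum>i<k. lam i)"
    by (simp add: sum_distrib_left)
  also have "\<dots> = (\<Sum>i<k. lam i * (2 * a i - 1))"
    by (simp add: sum_subtractf algebra_simps)
  also have "\<dots> \<le> (\<Sum>i<k. \<bar>lam i\<bar>)"
  proof (intro sum_mono)
    fix i assume "i \<in> {..<k}"
    then have "\<bar>2 * a i - 1\<bar> \<le> 1" using a[of i] by auto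
    then have "\<bar>lam i * (2 * a i - 1)\<bar> \<le> \<bar>lam i\<bar> * 1"
      unfolding abs_mult by (intro mult_left_mono) auto
    then show "lam i * (2 * a i - 1) \<le> \<bar>lam i\<bar>" by simp
  qed
  finally show ?thesis unfolding trace_norm_spectral[OF h sp] .
qed

section \<open>Maps, states and channels\<close>

subsection \<open>Index arithmetic\<close>

lemma pair_index_less:
  fixes i j m n :: nat
  assumes "i < m" "j < n" shows "i * n + j < m * n"
proof -
  have "i * n + j < Suc i * n" using assms by simp
  also have "\<dots> \<le> m * n" using assms by (intro mult_right_mono) auto
  finally show ?thesis .
qed

lemma sum_rotate: "(\<Sum>k\<in>A. \<Sum>l\<in>B. \<Sum>h\<in>C. f k l h) = (\<Sum>h\<in>C. \<Sum>k\<in>A. \<Sum>l\<in>B. f k l h)"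
proof -
  have "(\<Sum>k\<in>A. \<Sum>l\<in>B. \<Sum>h\<in>C. f k l h) = (\<Sum>k\<in>A. \<Sum>h\<in>C. \<Sum>l\<in>B. f k l h)"
    by (intro sum.cong refl sum.swap)
  also have "\<dots> = (\<Sum>h\<in>C. \<Sum>k\<in>A. \<Sum>l\<in>B. f k l h)" by (rule sum.swap)
  finally show ?thesis .
qed

lemma pair_index_div [simp]: "j < n \<Longrightarrow> (i * n + j) div n = (i::nat)"
  by simp

lemma pair_index_mod [simp]: "j < n \<Longrightarrow> (i * n + j) mod n = (j::nat)"
  by simp

lemma pair_index_cases:
  fixes r :: nat
  assumes "r < m * n" obtains i j where "i < m" "j < n" "r = i * n + j"
  using div_mod_less[OF assms] by (metis div_mult_mod_eq)

text \<open>The position of the single 1 in row \<open>r\<close> of \<open>swap_mat a b\<close>. It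
  maps output indices to input indices.\<close>

definition swap_idx :: "nat \<Rightarrow> nat \<Rightarrow> nat \<Rightarrow> nat" where
  "swap_idx a b r = (r mod a) * b + r div a"

lemma swap_idx_pair [simp]: "x < a \<Longrightarrow> swap_idx a b (y * a + x) = x * b + y"
  by (simp add: swap_idx_def)

lemma swap_idx_less: "r < b * a \<Longrightarrow> swap_idx a b r < a * b"
  unfolding swap_idx_def using div_mod_less pair_index_less by metis

lemma swap_idx_swap_idx: "r < a * b \<Longrightarrow> swap_idx a b (swap_idx b a r) = r"
  by (elim pair_index_cases) simp

subsection \<open>Maps that permute matrix entries\<close>

text \<open>The index map runs backwards, from output to input, so a composition of maps is followed
  from the last one applied to the first.\<close>

definition pulls :: "nat \<Rightarrow> nat \<Rightarrow> (nat \<Rightarrow> nat) \<Rightarrow> (cmat \<Rightarrow> cmat) \<Rightarrow> bool" where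
  "pulls d d' f F \<longleftrightarrow> (\<forall>r<d'. f r < d) \<and> (\<forall>X\<in>carrier_mat d d. F X \<in> carrier_mat d' d' \<and>
     (\<forall>r<d'. \<forall>c<d'. F X $$ (r, c) = X $$ (f r, f c)))"

lemma pulls_less: "pulls d d' f F \<Longrightarrow> r < d' \<Longrightarrow> f r < d"
  unfolding pulls_def by blast

lemma pulls_carrier: "pulls d d' f F \<Longrightarrow> X \<in> carrier_mat d d \<Longrightarrow> F X \<in> carrier_mat d' d'"
  unfolding pulls_def by blast

lemma pulls_entry:
  "pulls d d' f F \<Longrightarrow> X \<in> carrier_mat d d \<Longrightarrow> r < d' \<Longrightarrow> c < d' \<Longrightarrow> F X $$ (r, c) = X $$ (f r, f c)"
  unfolding pulls_def by blast

lemma pulls_id: "pulls d d (\<lambda>r. r) id"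
  unfolding pulls_def by simp

lemma pulls_comp:
  assumes "pulls d d' f F" "pulls d' d'' g G" shows "pulls d d'' (\<lambda>r. f (g r)) (G \<circ> F)"
  using assms unfolding pulls_def by (metis comp_apply)

lemma pulls_cong:
  assumes "pulls d d' f F" "\<And>r. r < d' \<Longrightarrow> f r = g r" shows "pulls d d' g F"
  using assms unfolding pulls_def by simp

lemma pulls_unique:
  assumes "pulls d d' f F" "pulls d d' f G" "X \<in> carrier_mat d d" shows "F X = G X"
  using pulls_carrier[OF assms(1,3)] pulls_carrier[OF assms(2,3)]
    pulls_entry[OF assms(1,3)] pulls_entry[OF assms(2,3)]
  by (intro eq_matI) auto

section \<open>Entries of tensor products of maps\<close>

lemma mat_unit_carrier [simp]: "mat_unit d i j \<in> carrier_mat d d"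
  unfolding mat_unit_def by simp

text \<open>Entries of matrix units act as a pair of Kronecker deltas; this collapses the sums that
  \<open>tensor_map\<close> introduces.\<close>

lemma sum_mat_unit:
  assumes "h < d" "h' < d"
  shows "(\<Sum>i<d. \<Sum>j<d. Y i j * mat_unit d i j $$ (h, h')) = Y h h'"
proof -
  have "(\<Sum>i<d. \<Sum>j<d. Y i j * mat_unit d i j $$ (h, h'))
      = (\<Sum>i<d. \<Sum>j<d. if i = h then if j = h' then Y h h' else 0 else 0)"
    using assms by (intro sum.cong) (auto simp: mat_unit_def)
  also have "\<dots> = (\<Sum>i<d. if i = h then Y h h' else 0)"
    using assms by (intro sum.cong) auto
  also have "\<dots> = Y h h'" using assms by simp
  finally show ?thesis .
qed

lemma tensor_map_carrier: "tensor_map d d' e e' F G \<rho> \<in> carrier_mat (d' * e') (d' * e')"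
  unfolding tensor_map_def by simp

lemma tensor_map_entry:
  assumes F: "\<And>i j. F (mat_unit d i j) \<in> carrier_mat d' d'"
    and G: "\<And>k l. G (mat_unit e k l) \<in> carrier_mat e' e'"
    and "r < d'" "r' < d'" "s < e'" "s' < e'"
  shows "tensor_map d d' e e' F G \<rho> $$ (r * e' + s, r' * e' + s') =
    (\<Sum>i<d. \<Sum>j<d. \<Sum>k<e. \<Sum>l<e. \<rho> $$ (i * e + k, j * e + l) *
      (F (mat_unit d i j) $$ (r, r') * G (mat_unit e k l) $$ (s, s')))"
proof -
  have "r * e' + s < d' * e'" "r' * e' + s' < d' * e'" using assms by (auto intro: pair_index_less)
  moreover have "kron (F (mat_unit d i j)) (G (mat_unit e k l)) $$ (r * e' + s, r' * e' + s')
      = F (mat_unit d i j) $$ (r, r') * G (mat_unit e k l) $$ (s, s')" for i j k l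
    using carrier_matD[OF F[of i j]] carrier_matD[OF G[of k l]] calculation assms
    unfolding kron_def by simp
  ultimately show ?thesis unfolding tensor_map_def by simp
qed

lemma tensor_map_id_entry:
  assumes G: "\<And>k l. G (mat_unit e k l) \<in> carrier_mat e' e'"
    and "p < m" "q < m" "s < e'" "t < e'"
  shows "tensor_map m m e e' id G \<rho> $$ (p * e' + s, q * e' + t) =
    (\<Sum>k<e. \<Sum>l<e. \<rho> $$ (p * e + k, q * e + l) * G (mat_unit e k l) $$ (s, t))"
proof -
  have "tensor_map m m e e' id G \<rho> $$ (p * e' + s, q * e' + t) =
    (\<Sum>i<m. \<Sum>j<m. (\<Sum>k<e. \<Sum>l<e. \<rho> $$ (i * e + k, j * e + l) * G (mat_unit e k l) $$ (s, t))
       * mat_unit m i j $$ (p, q))"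
    by (subst tensor_map_entry) (use assms in \<open>auto simp: sum_distrib_left sum_distrib_right mult_ac\<close>)
  then show ?thesis using assms by (simp only: sum_mat_unit)
qed

lemma tensor_map_trace_entry:
  assumes G: "\<And>k l. G (mat_unit e k l) \<in> carrier_mat e' e'" and "s < e'" "t < e'"
  shows "tensor_map d 1 e e' trace_map G \<rho> $$ (s, t) =
    (\<Sum>i<d. \<Sum>k<e. \<Sum>l<e. \<rho> $$ (i * e + k, i * e + l) * G (mat_unit e k l) $$ (s, t))"
proof -
  have tr: "trace (mat_unit d i j) = (if i = j then 1 else 0)" if "i < d" for i j
  proof -
    have "trace (mat_unit d i j) = (\<Sum>h<d. if h = i then if i = j then 1 else 0 else 0)"
      unfolding trace_def mat_unit_def by (auto intro!: sum.cong)
    then show ?thesis using that by simp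
  qed
  have "tensor_map d 1 e e' trace_map G \<rho> $$ (0 * e' + s, 0 * e' + t) =
    (\<Sum>i<d. \<Sum>j<d. \<Sum>k<e. \<Sum>l<e. \<rho> $$ (i * e + k, j * e + l) *
      (trace_map (mat_unit d i j) $$ (0, 0) * G (mat_unit e k l) $$ (s, t)))"
    by (rule tensor_map_entry) (use assms in \<open>auto simp: trace_map_def\<close>)
  also have "\<dots> = (\<Sum>i<d. \<Sum>j<d. if j = i then \<Sum>k<e. \<Sum>l<e. \<rho> $$ (i * e + k, i * e + l) *
      G (mat_unit e k l) $$ (s, t) else 0)"
    by (rule sum.cong[OF refl], rule sum.cong[OF refl]) (auto simp: trace_map_def tr)
  also have "\<dots> = (\<Sum>i<d. \<Sum>k<e. \<Sum>l<e. \<rho> $$ (i * e + k, i * e + l) * G (mat_unit e k l) $$ (s, t))"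
    by (rule sum.cong[OF refl]) simp
  finally show ?thesis by simp
qed

lemma pulls_tensor:
  assumes F: "pulls d d' f F" and G: "pulls e e' g G"
  shows "pulls (d * e) (d' * e') (\<lambda>r. f (r div e') * e + g (r mod e')) (tensor_map d d' e e' F G)"
  unfolding pulls_def
proof (intro conjI ballI allI impI tensor_map_carrier)
  fix r assume "r < d' * e'"
  then show "f (r div e') * e + g (r mod e') < d * e"
    using div_mod_less[of r d' e'] by (intro pair_index_less pulls_less[OF F] pulls_less[OF G])
next
  fix X r c assume "r < d' * e'" "c < d' * e'"
  then obtain r1 r2 c1 c2 where r: "r1 < d'" "r2 < e'" "r = r1 * e' + r2"
    and c: "c1 < d'" "c2 < e'" "c = c1 * e' + c2" by (metis pair_index_cases)
  have "tensor_map d d' e e' F G X $$ (r, c) =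
    (\<Sum>i<d. \<Sum>j<d. \<Sum>k<e. \<Sum>l<e. X $$ (i * e + k, j * e + l) *
      (F (mat_unit d i j) $$ (r1, c1) * G (mat_unit e k l) $$ (r2, c2)))"
    unfolding r c using r c by (intro tensor_map_entry pulls_carrier[OF F] pulls_carrier[OF G]) auto
  \<comment> \<open>Both maps relabel entries, so on matrix units they again give deltas, now at the
    relabelled positions.\<close>
  also have "\<dots> = (\<Sum>i<d. \<Sum>j<d. (\<Sum>k<e. \<Sum>l<e. X $$ (i * e + k, j * e + l) *
      mat_unit e k l $$ (g r2, g c2)) * mat_unit d i j $$ (f r1, f c1))"
    using r c by (simp add: pulls_entry[OF F] pulls_entry[OF G] sum_distrib_left sum_distrib_right mult_ac)
  also have "\<dots> = X $$ (f r1 * e + g r2, f c1 * e + g c2)"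
    using r c pulls_less[OF F] pulls_less[OF G] by (simp only: sum_mat_unit)
  finally show "tensor_map d d' e e' F G X $$ (r, c)
      = X $$ (f (r div e') * e + g (r mod e'), f (c div e') * e + g (c mod e'))"
    using r c by simp
qed

section \<open>Matrices with a single 1 in each row\<close>

definition perm_mat :: "nat \<Rightarrow> nat \<Rightarrow> (nat \<Rightarrow> nat) \<Rightarrow> cmat \<Rightarrow> bool" where
  "perm_mat d d' f U \<longleftrightarrow> (\<forall>r<d'. f r < d) \<and> U = mat d' d (\<lambda>(r, c). if c = f r then 1 else 0)"

text \<open>Multiplication by \<open>U\<close> on the left selects row \<open>f r\<close> of
  \<open>X\<close>, multiplication by its adjoint on the right selects column
  \<open>f c\<close>.\<close>

lemma pulls_unitary_channel:
  assumes "perm_mat d d' f U" shows "pulls d d' f (unitary_channel U)"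
  unfolding pulls_def
proof (intro conjI ballI allI impI)
  have U: "U = mat d' d (\<lambda>(r, c). if c = f r then 1 else 0)" and f: "\<And>r. r < d' \<Longrightarrow> f r < d"
    using assms unfolding perm_mat_def by auto
  show "f r < d" if "r < d'" for r using f that .
  fix X :: cmat assume X: "X \<in> carrier_mat d d"
  have Uc: "U \<in> carrier_mat d' d" using U by simp
  have adj: "mat_adjoint U \<in> carrier_mat d d'" using Uc unfolding mat_adjoint_def by auto
  show "unitary_channel U X \<in> carrier_mat d' d'"
    unfolding unitary_channel_def using Uc adj X by (meson mult_carrier_mat)
  fix r c assume rc: "r < d'" "c < d'"
  have UX: "(U * X) $$ (r, s) = X $$ (f r, s)" if "s < d" for s
  proof -
    have "(U * X) $$ (r, s) = (\<Sum>t<d. (if t = f r then 1 else 0) * X $$ (t, s))"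
      using rc that X unfolding U by (simp add: scalar_prod_def lessThan_atLeast0)
    also have "\<dots> = (\<Sum>t<d. if t = f r then X $$ (f r, s) else 0)"
      by (intro sum.cong) auto
    finally show ?thesis using f rc by simp
  qed
  have adjE: "mat_adjoint U $$ (s, c) = (if s = f c then 1 else 0)" if "s < d" for s
    using that rc Uc unfolding mat_adjoint_def by (simp add: mat_of_rows_index U)
  have "unitary_channel U X $$ (r, c) = (\<Sum>s<d. (U * X) $$ (r, s) * mat_adjoint U $$ (s, c))"
  proof -
    have prod: "(V * W) $$ (r, c) = (\<Sum>s<d. V $$ (r, s) * W $$ (s, c))"
      if "V \<in> carrier_mat d' d" "W \<in> carrier_mat d d'" for V W :: cmat
      using that rc by (simp add: scalar_prod_def lessThan_atLeast0)
    show ?thesis unfolding unitary_channel_def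
      using Uc X adj by (intro prod mult_carrier_mat)
  qed
  also have "\<dots> = (\<Sum>s<d. if s = f c then X $$ (f r, f c) else 0)"
    by (intro sum.cong) (auto simp: UX adjE)
  also have "\<dots> = X $$ (f r, f c)" using f rc by simp
  finally show "unitary_channel U X $$ (r, c) = X $$ (f r, f c)" .
qed

lemma perm_mat_one: "perm_mat d d (\<lambda>r. r) (1\<^sub>m d)"
  unfolding perm_mat_def by (auto intro!: eq_matI)

lemma perm_mat_swap: "perm_mat (a * b) (b * a) (swap_idx a b) (swap_mat a b)"
  unfolding perm_mat_def
proof (intro conjI allI impI swap_idx_less)
  have "(r div a = c mod b \<and> r mod a = c div b) \<longleftrightarrow> c = swap_idx a b r" if "r < b * a" for r c
    using div_mod_less[OF that] unfolding swap_idx_def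
    by (metis div_mult_mod_eq pair_index_div pair_index_mod)
  then show "swap_mat a b = mat (b * a) (a * b) (\<lambda>(r, c). if c = swap_idx a b r then 1 else 0)"
    unfolding swap_mat_def by (intro eq_matI) auto
qed

lemma perm_mat_kron:
  assumes A: "perm_mat d d' f A" and B: "perm_mat e e' g B"
  shows "perm_mat (d * e) (d' * e') (\<lambda>r. f (r div e') * e + g (r mod e')) (kron A B)"
  unfolding perm_mat_def
proof (intro conjI allI impI)
  have f: "\<And>r. r < d' \<Longrightarrow> f r < d" and g: "\<And>r. r < e' \<Longrightarrow> g r < e"
    and Adef: "A = mat d' d (\<lambda>(r, c). if c = f r then 1 else 0)"
    and Bdef: "B = mat e' e (\<lambda>(r, c). if c = g r then 1 else 0)"
    using A B unfolding perm_mat_def by auto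
  show "f (r div e') * e + g (r mod e') < d * e" if "r < d' * e'" for r
    using div_mod_less[OF that] f g by (intro pair_index_less)
  show "kron A B = mat (d' * e') (d * e) (\<lambda>(r, c). if c = f (r div e') * e + g (r mod e') then 1 else 0)"
  proof (rule eq_matI)
    fix r c assume "r < dim_row (mat (d' * e') (d * e) (\<lambda>(r, c). if c = f (r div e') * e + g (r mod e') then 1 else 0))"
      "c < dim_col (mat (d' * e') (d * e) (\<lambda>(r, c). if c = f (r div e') * e + g (r mod e') then 1 else 0))"
    then have rc: "r < d' * e'" "c < d * e" by auto
    note dm = div_mod_less[OF rc(1)] div_mod_less[OF rc(2)]
    have "(c div e = f (r div e') \<and> c mod e = g (r mod e')) \<longleftrightarrow> c = f (r div e') * e + g (r mod e')"
      using g[OF dm(2)] by (metis div_mult_mod_eq pair_index_div pair_index_mod)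
    then show "kron A B $$ (r, c) = mat (d' * e') (d * e)
        (\<lambda>(r, c). if c = f (r div e') * e + g (r mod e') then 1 else 0) $$ (r, c)"
      using rc dm unfolding kron_def Adef Bdef by auto
  qed (auto simp: kron_def Adef Bdef)
qed

lemma pulls_swap_channel: "pulls (a * b) (b * a) (swap_idx a b) (swap_channel a b)"
  unfolding swap_channel_def by (intro pulls_unitary_channel perm_mat_swap)

subsection \<open>Tensor powers of the SWAP channel\<close>

lemma pulls_swap_middle:
  "pulls (p * (q * r) * s) (p * (r * q) * s)
     (\<lambda>i. (i div s div (r * q) * (q * r) + swap_idx q r (i div s mod (r * q))) * s + i mod s)
     (swap_middle p q r s)"
  unfolding swap_middle_def
  by (intro pulls_unitary_channel perm_mat_kron perm_mat_one perm_mat_swap)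

text \<open>Read in mixed radix, \<open>i\<close> has the digits w, x, y, z, and the formula
  exchanges x and y. The proof regroups the two middle digits into one digit to base
  \<open>r * q\<close>.\<close>

lemma swap_middle_idx:
  fixes w p q r s :: nat
  assumes "x < r" "y < q" "z < s"
  defines "i \<equiv> ((w * r + x) * q + y) * s + z"
  shows "(i div s div (r * q) * (q * r) + swap_idx q r (i div s mod (r * q))) * s + i mod s
    = ((w * q + y) * r + x) * s + z"
proof -
  have "i div s = (w * r + x) * q + y" "i mod s = z"
    unfolding i_def using assms by simp_all
  then have "i div s = w * (r * q) + (x * q + y)" "i mod s = z"
    by (simp_all add: algebra_simps)
  moreover have "(w * (r * q) + (x * q + y)) div (r * q) = w"
    "(w * (r * q) + (x * q + y)) mod (r * q) = x * q + y"
    using pair_index_less[OF assms(1,2)] by simp_all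
  ultimately have "(i div s div (r * q) * (q * r) + swap_idx q r (i div s mod (r * q))) * s + i mod s
      = (w * (q * r) + (y * r + x)) * s + z"
    using assms(2) by (simp only: swap_idx_pair)
  then show ?thesis by (simp add: algebra_simps)
qed

text \<open>In the induction step two regroupings surround a pair of swaps; on digits the three
  index maps combine to one swap of the enlarged systems.\<close>

lemma pulls_tensor_power:
  "pulls (a ^ n * b ^ n) (b ^ n * a ^ n) (swap_idx (a ^ n) (b ^ n))
     (tensor_power a b b a (swap_channel a b) n)"
proof (induction n)
  case 0
  have "pulls 1 1 (swap_idx 1 1) id"
    by (rule pulls_cong[OF pulls_id]) (simp add: swap_idx_def)
  then show ?case by (simp add: id_def)
next
  case (Suc n)
  define p where "p = a ^ n"
  define q where "q = b ^ n"
  let ?T = "tensor_map (p * q) (q * p) (a * b) (b * a) (tensor_power a b b a (swap_channel a b) n) (swap_channel a b)"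
  let ?mid = "\<lambda>p q r s i. (i div s div (r * q) * (q * r) + swap_idx q r (i div s mod (r * q))) * s + i mod s"
  let ?t = "\<lambda>i. swap_idx p q (i div (b * a)) * (a * b) + swap_idx a b (i mod (b * a))"
  have M1: "pulls (a * p * (b * q)) (p * q * (a * b)) (?mid p a q b) (swap_middle p a q b)"
    using pulls_swap_middle[of p a q b] by (simp add: mult_ac)
  have T: "pulls (p * q * (a * b)) (q * p * (b * a)) ?t ?T"
    using Suc.IH unfolding p_def q_def by (intro pulls_tensor pulls_swap_channel)
  have M2: "pulls (q * p * (b * a)) (b * q * (a * p)) (?mid q p b a) (swap_middle q p b a)"
    using pulls_swap_middle[of q p b a] by (simp add: mult_ac)
  have "?mid p a q b (?t (?mid q p b a i)) = swap_idx (a * p) (b * q) i"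
    if i: "i < b * q * (a * p)" for i
  proof -
    \<comment> \<open>The digits \<open>y1\<close>, \<open>x1\<close> belong to the first n copies
      of B and A, and \<open>y2\<close>, \<open>x2\<close> to the new copy. The three maps lead from
      (y1, y2, x1, x2) via (y1, x1, y2, x2) and (x1, y1, x2, y2) to (x1, x2, y1, y2).\<close>
    have "i < q * b * p * a" using i by (simp add: mult_ac)
    then obtain y1 y2 x1 x2 where *: "y1 < q" "y2 < b" "x1 < p" "x2 < a"
      "i = ((y1 * b + y2) * p + x1) * a + x2"
      by (metis pair_index_cases)
    have less: "y1 * p + x1 < q * p" "y2 * a + x2 < b * a" "x1 * a + x2 < a * p"
      using pair_index_less[OF *(1,3)] pair_index_less[OF *(2,4)] pair_index_less[OF *(3,4)]
      by (simp_all add: mult.commute)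
    have "?mid q p b a i = ((y1 * p + x1) * b + y2) * a + x2"
      unfolding *(5) using * by (intro swap_middle_idx)
    also have "\<dots> = (y1 * p + x1) * (b * a) + (y2 * a + x2)" by (simp add: algebra_simps)
    also have "?t \<dots> = (x1 * q + y1) * (a * b) + (x2 * b + y2)"
      using * less by (simp del: mult.assoc add: swap_idx_pair)
    also have "\<dots> = ((x1 * q + y1) * a + x2) * b + y2" by (simp add: algebra_simps)
    also have "?mid p a q b \<dots> = ((x1 * a + x2) * q + y1) * b + y2"
      using * by (intro swap_middle_idx)
    also have "\<dots> = (x1 * a + x2) * (b * q) + (y1 * b + y2)" by (simp add: algebra_simps)
    also have "\<dots> = swap_idx (a * p) (b * q) ((y1 * b + y2) * (a * p) + (x1 * a + x2))"
      using less by simp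
    also have "(y1 * b + y2) * (a * p) + (x1 * a + x2) = i" unfolding * by (simp add: algebra_simps)
    finally show ?thesis .
  qed
  then have "pulls (a * p * (b * q)) (b * q * (a * p)) (swap_idx (a * p) (b * q))
      (swap_middle q p b a \<circ> (?T \<circ> swap_middle p a q b))"
    by (intro pulls_cong[OF pulls_comp[OF pulls_comp[OF M1 T] M2]])
  then show ?case by (simp add: p_def q_def comp_def)
qed

subsection \<open>States and channels\<close>

text \<open>The matrix has Kraus form: a sum over k of V_k \<rho> V_k^*, where row r of V_k has a 1
  in column \<open>f k r\<close> if \<open>g k r\<close> holds and is zero otherwise. Its quadratic
  form at \<open>x\<close> is the sum of those of \<rho> at the vectors \<open>w k\<close> = V_k^*
  x. Partial traces, reorderings of factors and the constant channel are all of this kind.\<close>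

lemma positive_op_pull:
  assumes \<rho>: "positive_op D \<rho>" and f: "\<And>k r. k \<in> S \<Longrightarrow> r < d' \<Longrightarrow> f k r < D"
  shows "positive_op d' (mat d' d' (\<lambda>(r, c). \<Sum>k\<in>S. if g k r \<and> g k c then \<rho> $$ (f k r, f k c) else 0))"
    (is "positive_op d' ?M")
  unfolding positive_op_iff
proof (intro conjI allI)
  fix x :: "nat \<Rightarrow> complex"
  define w where "w k j = (\<Sum>r<d'. if f k r = j then if g k r then x r else 0 else 0)" for k j
  \<comment> \<open>Stated for \<open>id\<close> and \<open>cnj\<close> at once, since
    \<open>w k\<close> enters the quadratic form both plain and conjugated.\<close>
  have collapse: "(\<Sum>j<D. h j * F (w k j)) = (\<Sum>r<d'. if g k r then h (f k r) * F (x r) else 0)"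
    if "k \<in> S" "F = id \<or> F = cnj" for k F and h :: "nat \<Rightarrow> complex"
  proof -
    have "F (w k j) = (\<Sum>r<d'. if f k r = j then if g k r then F (x r) else 0 else 0)" for j
      using that(2) unfolding w_def by (auto intro!: sum.cong simp: cnj_sum)
    then have "(\<Sum>j<D. h j * F (w k j))
        = (\<Sum>j<D. \<Sum>r<d'. h j * (if f k r = j then if g k r then F (x r) else 0 else 0))"
      by (simp only: sum_distrib_left)
    also have "\<dots> = (\<Sum>j<D. \<Sum>r<d'. if f k r = j then if g k r then h j * F (x r) else 0 else 0)"
      by (intro sum.cong refl) auto
    also have "\<dots> = (\<Sum>r<d'. \<Sum>j<D. if f k r = j then if g k r then h j * F (x r) else 0 else 0)"
      by (rule sum.swap)
    also have "\<dots> = (\<Sum>r<d'. if g k r then h (f k r) * F (x r) else 0)"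
      using f that(1) by (intro sum.cong) auto
    finally show ?thesis .
  qed
  have "ip d' (mapply d' ?M x) x
      = (\<Sum>r<d'. \<Sum>c<d'. \<Sum>k\<in>S. if g k r \<and> g k c then \<rho> $$ (f k r, f k c) * x c * cnj (x r) else 0)"
    unfolding ip_def mapply_def sum_distrib_right
    by (intro sum.cong refl) (auto simp: sum_distrib_right intro!: sum.cong)
  also have "\<dots> = (\<Sum>r<d'. \<Sum>k\<in>S. \<Sum>c<d'. if g k r \<and> g k c then \<rho> $$ (f k r, f k c) * x c * cnj (x r) else 0)"
    by (intro sum.cong refl sum.swap)
  also have "\<dots> = (\<Sum>k\<in>S. \<Sum>r<d'. \<Sum>c<d'. if g k r \<and> g k c then \<rho> $$ (f k r, f k c) * x c * cnj (x r) else 0)"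
    by (rule sum.swap)
  also have "\<dots> = (\<Sum>k\<in>S. ip D (mapply D \<rho> (w k)) (w k))"
  proof (intro sum.cong refl)
    fix k assume k: "k \<in> S"
    have "ip D (mapply D \<rho> (w k)) (w k)
        = (\<Sum>r<d'. if g k r then mapply D \<rho> (w k) (f k r) * cnj (x r) else 0)"
      unfolding ip_def using collapse[OF k, of cnj] by simp
    also have "\<dots> = (\<Sum>r<d'. if g k r then
        (\<Sum>c<d'. if g k c then \<rho> $$ (f k r, f k c) * x c else 0) * cnj (x r) else 0)"
      unfolding mapply_def using collapse[OF k, of id] by (simp cong: if_cong)
    also have "\<dots> = (\<Sum>r<d'. \<Sum>c<d'. if g k r \<and> g k c then \<rho> $$ (f k r, f k c) * x c * cnj (x r) else 0)"
      by (intro sum.cong refl) (auto simp: sum_distrib_right intro!: sum.cong)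
    finally show "(\<Sum>r<d'. \<Sum>c<d'. if g k r \<and> g k c then \<rho> $$ (f k r, f k c) * x c * cnj (x r) else 0)
        = ip D (mapply D \<rho> (w k)) (w k)" by simp
  qed
  finally have "ip d' (mapply d' ?M x) x = (\<Sum>k\<in>S. ip D (mapply D \<rho> (w k)) (w k))" .
  then show "0 \<le> ip d' (mapply d' ?M x) x"
    using \<rho> unfolding positive_op_iff by (simp add: sum_nonneg)
qed simp

lemma states_carrier: "\<rho> \<in> states d \<Longrightarrow> \<rho> \<in> carrier_mat d d"
  unfolding states_def positive_op_iff by blast

lemma trace_carrier: "A \<in> carrier_mat n n \<Longrightarrow> trace A = (\<Sum>i<n. A $$ (i, i))"
  unfolding trace_def by simp

lemma states_pull:
  assumes \<rho>: "\<rho> \<in> states D" and f: "\<And>k r. k \<in> S \<Longrightarrow> r < d' \<Longrightarrow> f k r < D"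
    and tr: "(\<Sum>r<d'. \<Sum>k\<in>S. \<rho> $$ (f k r, f k r)) = (\<Sum>r<D. \<rho> $$ (r, r))"
  shows "mat d' d' (\<lambda>(r, c). \<Sum>k\<in>S. \<rho> $$ (f k r, f k c)) \<in> states d'"
proof -
  have "positive_op d' (mat d' d' (\<lambda>(r, c). \<Sum>k\<in>S. \<rho> $$ (f k r, f k c)))"
    using positive_op_pull[of D \<rho> S d' f "\<lambda>_ _. True"] \<rho> f unfolding states_def by simp
  moreover have "trace \<rho> = 1" using \<rho> unfolding states_def by simp
  ultimately show ?thesis
    using tr trace_carrier[OF states_carrier[OF \<rho>]] unfolding states_def by (simp add: trace_def)
qed

lemma channel_carrier: "C \<in> channels e e' \<Longrightarrow> X \<in> carrier_mat e e \<Longrightarrow> C X \<in> carrier_mat e' e'"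
  unfolding channels_def linear_map_def by blast

lemma channel_trace: "C \<in> channels e e' \<Longrightarrow> X \<in> carrier_mat e e \<Longrightarrow> trace (C X) = trace X"
  unfolding channels_def trace_preserving_def by blast

lemma trace_tensor_map_id:
  assumes G: "\<And>k l. G (mat_unit e k l) \<in> carrier_mat e' e'"
    and tr: "\<And>k l. trace (G (mat_unit e k l)) = trace (mat_unit e k l)"
    and \<rho>: "\<rho> \<in> carrier_mat (m * e) (m * e)"
  shows "trace (tensor_map m m e e' id G \<rho>) = trace \<rho>"
proof -
  have "trace (tensor_map m m e e' id G \<rho>)
      = (\<Sum>p<m. \<Sum>s<e'. \<Sum>k<e. \<Sum>l<e. \<rho> $$ (p * e + k, p * e + l) * G (mat_unit e k l) $$ (s, s))"
    unfolding trace_carrier[OF tensor_map_carrier] sum_index_product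
    by (intro sum.cong refl tensor_map_id_entry G) auto
  also have "\<dots> = (\<Sum>p<m. \<Sum>k<e. \<Sum>l<e. \<Sum>s<e'. \<rho> $$ (p * e + k, p * e + l) * G (mat_unit e k l) $$ (s, s))"
    by (intro sum.cong refl sum_rotate[symmetric])
  also have "\<dots> = (\<Sum>p<m. \<Sum>k<e. \<Sum>l<e. \<rho> $$ (p * e + k, p * e + l) * trace (mat_unit e k l))"
    by (simp add: tr[symmetric] trace_carrier[OF G] sum_distrib_left)
  \<comment> \<open>The trace of the matrix unit is expanded again, so that the sum over matrix
    units can be collapsed before the trace is taken.\<close>
  also have "\<dots> = (\<Sum>p<m. \<Sum>h<e. \<Sum>k<e. \<Sum>l<e. \<rho> $$ (p * e + k, p * e + l) * mat_unit e k l $$ (h, h))"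
    unfolding trace_carrier[OF mat_unit_carrier] sum_distrib_left
    by (rule sum.cong[OF refl], rule sum_rotate)
  also have "\<dots> = (\<Sum>p<m. \<Sum>h<e. \<rho> $$ (p * e + h, p * e + h))"
    by (intro sum.cong refl) (simp only: sum_mat_unit lessThan_iff)
  also have "\<dots> = trace \<rho>" unfolding trace_carrier[OF \<rho>] sum_index_product ..
  finally show ?thesis .
qed

lemma channel_tensor_states:
  assumes C: "C \<in> channels e e'" and \<rho>: "\<rho> \<in> states (m * e)"
  shows "tensor_map m m e e' id C \<rho> \<in> states (m * e')"
proof -
  have "positive_op (m * e') (tensor_map m m e e' id C \<rho>)"
    using C \<rho> unfolding channels_def completely_positive_def states_def by blast
  moreover have "trace (tensor_map m m e e' id C \<rho>) = trace \<rho>"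
    by (intro trace_tensor_map_id channel_carrier[OF C] channel_trace[OF C] states_carrier[OF \<rho>]
        mat_unit_carrier)
  ultimately show ?thesis using \<rho> unfolding states_def by simp
qed

text \<open>The channel that discards its input and prepares the first basis state.\<close>

lemma channels_nonempty:
  assumes "1 \<le> e'" shows "channels e e' \<noteq> {}"
proof -
  define F where "F X = mat e' e' (\<lambda>(r, c). if r = 0 \<and> c = 0 then \<Sum>i<e. X $$ (i, i) else 0)"
    for X :: cmat
  have Fc: "F X \<in> carrier_mat e' e'" for X unfolding F_def by simp
  have "linear_map e e' F"
    unfolding linear_map_def F_def
    by (auto intro!: eq_matI simp: sum.distrib sum_distrib_left)
  moreover have trF: "trace (F X) = trace X" if "X \<in> carrier_mat e e" for X
  proof -
    have "trace (F X) = (\<Sum>r<e'. if r = 0 then trace X else 0)"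
      unfolding trace_carrier[OF Fc] trace_carrier[OF that] by (auto simp: F_def intro!: sum.cong)
    then show ?thesis using assms by simp
  qed
  moreover have "completely_positive e e' F" unfolding completely_positive_def
  proof (intro allI impI)
    fix k \<rho> assume \<rho>: "positive_op (k * e) \<rho>"
    \<comment> \<open>The partial trace of \<rho> over the input, tensored with the projection onto
      the first basis vector: the filter keeps entries whose two output digits are both 0.\<close>
    let ?M = "mat (k * e') (k * e') (\<lambda>(r, c). \<Sum>i<e. if r mod e' = 0 \<and> c mod e' = 0
      then \<rho> $$ (r div e' * e + i, c div e' * e + i) else 0)"
    have "positive_op (k * e') ?M"
      by (rule positive_op_pull[OF \<rho>, where g = "\<lambda>_ r. r mod e' = 0"])
        (auto intro!: pair_index_less dest: div_mod_less)
    moreover have "tensor_map k k e e' id F \<rho> = ?M"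
    proof (rule eq_matI)
      fix r c assume "r < dim_row ?M" "c < dim_col ?M"
      then have rc: "r < k * e'" "c < k * e'" by auto
      then obtain p s q t where *: "p < k" "s < e'" "r = p * e' + s" "q < k" "t < e'" "c = q * e' + t"
        by (metis pair_index_cases)
      have "tensor_map k k e e' id F \<rho> $$ (r, c)
          = (\<Sum>h<e. \<Sum>l<e. \<rho> $$ (p * e + h, q * e + l) * F (mat_unit e h l) $$ (s, t))"
        unfolding * using * by (intro tensor_map_id_entry Fc)
      also have "\<dots> = (\<Sum>h<e. \<Sum>l<e. \<Sum>i<e. (if s = 0 \<and> t = 0 then \<rho> $$ (p * e + h, q * e + l) else 0)
          * mat_unit e h l $$ (i, i))"
        using * by (auto simp: F_def sum_distrib_left intro!: sum.cong)
      also have "\<dots> = (\<Sum>i<e. \<Sum>h<e. \<Sum>l<e. (if s = 0 \<and> t = 0 then \<rho> $$ (p * e + h, q * e + l) else 0)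
          * mat_unit e h l $$ (i, i))"
        by (rule sum_rotate)
      also have "\<dots> = (\<Sum>i<e. if s = 0 \<and> t = 0 then \<rho> $$ (p * e + i, q * e + i) else 0)"
        by (intro sum.cong refl) (simp only: sum_mat_unit lessThan_iff)
      also have "\<dots> = ?M $$ (r, c)"
      proof -
        have "r div e' = p" "r mod e' = s" "c div e' = q" "c mod e' = t" using * by simp_all
        then show ?thesis using rc by (simp cong: if_cong)
      qed
      finally show "tensor_map k k e e' id F \<rho> $$ (r, c) = ?M $$ (r, c)" .
    qed (simp_all add: tensor_map_def)
    ultimately show "positive_op (k * e') (tensor_map k k e e' id F \<rho>)" by simp
  qed
  ultimately have "F \<in> channels e e'" unfolding channels_def trace_preserving_def by blast
  then show ?thesis by blast
qed

section \<open>The SWAP gate\<close>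

subsection \<open>Diamond norm of a difference of channels\<close>

lemma trace_norm_states_diff_le:
  assumes "P \<in> states n" "Q \<in> states n" shows "trace_norm (P - Q) \<le> 2"
  using trace_norm_diff_le[of n P Q] assms unfolding states_def by simp

lemma trace_norm_states_diff_ge:
  assumes P: "P \<in> states n" and Q: "Q \<in> states n" and j: "j < n"
  shows "2 * Re (P $$ (j, j) - Q $$ (j, j)) \<le> trace_norm (P - Q)"
proof -
  have c: "P \<in> carrier_mat n n" "Q \<in> carrier_mat n n" using P Q by (auto intro: states_carrier)
  have "hermitian n (P - Q)"
    using P Q unfolding states_def by (intro hermitian_minus positive_op_hermitian) auto
  moreover have "trace (P - Q) = trace P - trace Q"
    using c by (auto simp: trace_def sum_subtractf)
  then have "trace (P - Q) = 0" using P Q unfolding states_def by simp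
  ultimately have "2 * Re ((P - Q) $$ (j, j)) \<le> trace_norm (P - Q)"
    using j by (rule trace_norm_ge_diag)
  then show ?thesis using c j by simp
qed

lemma basis_state: "j < n \<Longrightarrow> mat_unit n j j \<in> states n"
proof -
  assume j: "j < n"
  define A where "A = mat_unit n j j"
  have tr: "trace A = 1"
    using sum_mat_unit[of _ n _ "\<lambda>_ _. 1"] j unfolding trace_def A_def mat_unit_def by simp
  have "ip n (mapply n A x) x = of_real ((cmod (x j))\<^sup>2)" for x
  proof -
    have "mapply n A x r = (if r = j then x j else 0)" if "r < n" for r
    proof -
      have "mapply n A x r = (\<Sum>c<n. if c = j then if r = j then x j else 0 else 0)"
        unfolding mapply_def A_def mat_unit_def using that by (intro sum.cong) auto
      then show ?thesis using j by simp
    qed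
    then have "ip n (mapply n A x) x = (\<Sum>r<n. if r = j then x j * cnj (x j) else 0)"
      unfolding ip_def by (intro sum.cong) auto
    then show ?thesis using j unfolding complex_norm_square by simp
  qed
  then have "positive_op n A" unfolding positive_op_iff A_def by (simp add: less_eq_complex_def)
  then show ?thesis using tr unfolding states_def A_def by simp
qed

lemma states_nonempty: "0 < n \<Longrightarrow> states n \<noteq> {}"
  using basis_state by blast

lemma diamond_norm_diff_le:
  assumes "0 < d"
    and "\<And>\<rho>. \<rho> \<in> states (d * d) \<Longrightarrow> tensor_map d d d d' id L \<rho> = P \<rho> - Q \<rho>"
    and "\<And>\<rho>. \<rho> \<in> states (d * d) \<Longrightarrow> P \<rho> \<in> states (d * d')"
    and "\<And>\<rho>. \<rho> \<in> states (d * d) \<Longrightarrow> Q \<rho> \<in> states (d * d')"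
  shows "diamond_norm d d' L \<le> 2"
  unfolding diamond_norm_def
  using assms states_nonempty[of "d * d"] by (intro cSUP_least) (auto intro: trace_norm_states_diff_le)

text \<open>One test state bounds a real supremum from below only if the supremum is over a bounded
  set; the bound 2 for differences of states supplies this.\<close>

lemma diamond_norm_diff_ge:
  assumes L: "\<And>\<rho>. \<rho> \<in> states (d * d) \<Longrightarrow> tensor_map d d d d' id L \<rho> = P \<rho> - Q \<rho>"
    and P: "\<And>\<rho>. \<rho> \<in> states (d * d) \<Longrightarrow> P \<rho> \<in> states (d * d')"
    and Q: "\<And>\<rho>. \<rho> \<in> states (d * d) \<Longrightarrow> Q \<rho> \<in> states (d * d')"
    and \<rho>: "\<rho> \<in> states (d * d)" and j: "j < d * d'"
  shows "2 * Re (P \<rho> $$ (j, j) - Q \<rho> $$ (j, j)) \<le> diamond_norm d d' L"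
proof -
  have "bdd_above ((\<lambda>\<rho>. trace_norm (tensor_map d d d d' id L \<rho>)) ` states (d * d))"
    using L P Q by (intro bdd_aboveI[of _ 2]) (auto intro: trace_norm_states_diff_le)
  then have "trace_norm (tensor_map d d d d' id L \<rho>) \<le> diamond_norm d d' L"
    unfolding diamond_norm_def by (rule cSUP_upper[OF \<rho>])
  then show ?thesis using trace_norm_states_diff_ge[OF P[OF \<rho>] Q[OF \<rho>] j] L[OF \<rho>] by simp
qed

subsection \<open>Signalling of the SWAP gate\<close>

text \<open>After SWAP the discarded output A' is the input B, so this is the partial trace over B
  of a state of E A B, with the reference E of dimension \<open>a * b\<close>.\<close>

definition signal_swap :: "nat \<Rightarrow> nat \<Rightarrow> cmat \<Rightarrow> cmat" where
  "signal_swap a b \<rho> = mat (a * b * a) (a * b * a) (\<lambda>(r, c). \<Sum>i<b. \<rho> $$ (r * b + i, c * b + i))"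

text \<open>The extension of Tr_A \<otimes> C by the reference E: first \<open>C\<close> acts on B
  with E A as bystander, then A, now the middle factor with index \<open>x\<close>, is traced out.
  In this order the complete positivity of \<open>C\<close> applies directly.\<close>

definition signal_local :: "nat \<Rightarrow> nat \<Rightarrow> (cmat \<Rightarrow> cmat) \<Rightarrow> cmat \<Rightarrow> cmat" where
  "signal_local a b C \<rho> = mat (a * b * a) (a * b * a) (\<lambda>(r, c). \<Sum>x<a.
     tensor_map (a * b * a) (a * b * a) b a id C \<rho>
       $$ ((r div a * a + x) * a + r mod a, (c div a * a + x) * a + c mod a))"

lemma signal_swap_states:
  assumes "\<rho> \<in> states (a * b * (a * b))" shows "signal_swap a b \<rho> \<in> states (a * b * a)"
proof -
  have "\<rho> \<in> states (a * b * a * b)" using assms by (simp add: mult.assoc)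
  then show ?thesis unfolding signal_swap_def
    by (rule states_pull) (auto intro: pair_index_less simp: sum_index_product)
qed

lemma signal_local_states:
  assumes C: "C \<in> channels b a" and \<rho>: "\<rho> \<in> states (a * b * (a * b))"
  shows "signal_local a b C \<rho> \<in> states (a * b * a)"
proof -
  define d where "d = a * b"
  have "\<rho> \<in> states (d * a * b)" using \<rho> by (simp add: d_def mult.assoc)
  then have \<tau>: "tensor_map (d * a) (d * a) b a id C \<rho> \<in> states (d * a * a)" (is "?\<tau> \<in> _")
    by (rule channel_tensor_states[OF C])
  show ?thesis unfolding signal_local_def d_def[symmetric]
  proof (rule states_pull[OF \<tau>])
    fix x r assume "x \<in> {..<a}" "r < d * a"
    then show "(r div a * a + x) * a + r mod a < d * a * a"
      using div_mod_less[of r d a] by (intro pair_index_less) auto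
  next
    have "(\<Sum>r<d * a. \<Sum>x<a. ?\<tau> $$ ((r div a * a + x) * a + r mod a, (r div a * a + x) * a + r mod a))
        = (\<Sum>p<d. \<Sum>s<a. \<Sum>x<a. ?\<tau> $$ ((p * a + x) * a + s, (p * a + x) * a + s))"
      unfolding sum_index_product by (intro sum.cong refl) (simp only: pair_index_div pair_index_mod lessThan_iff)
    also have "\<dots> = (\<Sum>p<d. \<Sum>x<a. \<Sum>s<a. ?\<tau> $$ ((p * a + x) * a + s, (p * a + x) * a + s))"
      by (rule sum.cong[OF refl], rule sum.swap)
    also have "\<dots> = (\<Sum>r<d * a * a. ?\<tau> $$ (r, r))" unfolding sum_index_product ..
    finally show "(\<Sum>r<d * a. \<Sum>x<a. ?\<tau> $$ ((r div a * a + x) * a + r mod a, (r div a * a + x) * a + r mod a))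
        = (\<Sum>r<d * a * a. ?\<tau> $$ (r, r))" .
  qed
qed

text \<open>Since \<open>tensor_map\<close> sees a map only through its values on matrix units, both
  terms are evaluated there (\<open>LE\<close>), and the deltas in the input indices are then summed
  away.\<close>

lemma signalling_map_split:
  assumes C: "C \<in> channels b a" and U: "pulls (a * b) (b * a) (swap_idx a b) U"
    and \<rho>: "\<rho> \<in> states (a * b * (a * b))"
  shows "tensor_map (a * b) (a * b) (a * b) a id
      (\<lambda>\<rho>. tensor_map b 1 a a trace_map id (U \<rho>) - tensor_map a 1 b a trace_map C \<rho>) \<rho>
    = signal_swap a b \<rho> - signal_local a b C \<rho>" (is "tensor_map _ _ _ _ id ?L \<rho> = _")
proof -
  define d where "d = a * b"
  have Cc: "C (mat_unit b k l) \<in> carrier_mat a a" for k l by (rule channel_carrier[OF C]) simp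
  have Lc: "?L X \<in> carrier_mat a a" for X
    using tensor_map_carrier[of a 1 b a trace_map C X] by (simp add: minus_mat_def)
  have LE: "?L (mat_unit d k l) $$ (s, t)
      = (\<Sum>i<b. mat_unit d k l $$ (s * b + i, t * b + i))
        - (\<Sum>i<a. \<Sum>k'<b. \<Sum>l'<b. mat_unit d k l $$ (i * b + k', i * b + l') * C (mat_unit b k' l') $$ (s, t))"
    if st: "s < a" "t < a" for k l s t
  proof -
    have "tensor_map b 1 a a trace_map id (U (mat_unit d k l)) $$ (s, t)
        = (\<Sum>i<b. U (mat_unit d k l) $$ (i * a + s, i * a + t))"
      using st by (subst tensor_map_trace_entry) (auto simp: sum_mat_unit)
    also have "\<dots> = (\<Sum>i<b. mat_unit d k l $$ (s * b + i, t * b + i))"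
    proof (rule sum.cong[OF refl])
      fix i assume "i \<in> {..<b}"
      then show "U (mat_unit d k l) $$ (i * a + s, i * a + t) = mat_unit d k l $$ (s * b + i, t * b + i)"
        using st by (subst pulls_entry[OF U]) (auto simp: d_def intro: pair_index_less)
    qed
    finally have "tensor_map b 1 a a trace_map id (U (mat_unit d k l)) $$ (s, t)
        = (\<Sum>i<b. mat_unit d k l $$ (s * b + i, t * b + i))" .
    moreover have "tensor_map a 1 b a trace_map C (mat_unit d k l) $$ (s, t)
        = (\<Sum>i<a. \<Sum>k'<b. \<Sum>l'<b. mat_unit d k l $$ (i * b + k', i * b + l') * C (mat_unit b k' l') $$ (s, t))"
      by (rule tensor_map_trace_entry[where G = C, OF Cc st])
    ultimately show ?thesis
      using st tensor_map_carrier[of a 1 b a trace_map C "mat_unit d k l"] by simp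
  qed
  have "tensor_map d d d a id ?L \<rho> = signal_swap a b \<rho> - signal_local a b C \<rho>"
  proof (rule eq_matI)
    fix r c assume "r < dim_row (signal_swap a b \<rho> - signal_local a b C \<rho>)"
      "c < dim_col (signal_swap a b \<rho> - signal_local a b C \<rho>)"
    then have rc: "r < d * a" "c < d * a" by (auto simp: signal_local_def d_def)
    then obtain p s q t where *: "p < d" "s < a" "r = p * a + s" "q < d" "t < a" "c = q * a + t"
      by (metis pair_index_cases)
    have lt: "x * b + i < d" if "x < a" "i < b" for x i
      using that unfolding d_def by (rule pair_index_less)
    have "tensor_map d d d a id ?L \<rho> $$ (r, c)
        = (\<Sum>k<d. \<Sum>l<d. \<rho> $$ (p * d + k, q * d + l) * ?L (mat_unit d k l) $$ (s, t))"
      unfolding * using * by (intro tensor_map_id_entry Lc)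
    also have "\<dots> = (\<Sum>k<d. \<Sum>l<d. \<Sum>i<b. \<rho> $$ (p * d + k, q * d + l) * mat_unit d k l $$ (s * b + i, t * b + i))
        - (\<Sum>k<d. \<Sum>l<d. \<Sum>i<a. \<Sum>k'<b. \<Sum>l'<b. \<rho> $$ (p * d + k, q * d + l)
            * mat_unit d k l $$ (i * b + k', i * b + l') * C (mat_unit b k' l') $$ (s, t))"
      unfolding LE[OF *(2,5)] right_diff_distrib sum_subtractf sum_distrib_left mult.assoc ..
    also have "(\<Sum>k<d. \<Sum>l<d. \<Sum>i<b. \<rho> $$ (p * d + k, q * d + l) * mat_unit d k l $$ (s * b + i, t * b + i))
        = (\<Sum>i<b. \<Sum>k<d. \<Sum>l<d. \<rho> $$ (p * d + k, q * d + l) * mat_unit d k l $$ (s * b + i, t * b + i))"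
      by (rule sum_rotate)
    also have "\<dots> = (\<Sum>i<b. \<rho> $$ (p * d + (s * b + i), q * d + (t * b + i)))"
      using * lt by (intro sum.cong[OF refl] sum_mat_unit) auto
    also have "\<dots> = signal_swap a b \<rho> $$ (r, c)"
      using rc unfolding signal_swap_def d_def * by (simp add: algebra_simps)
    \<comment> \<open>The two sums over matrix units are moved innermost, past one outer index per
      rotation, so that \<open>sum_mat_unit\<close> applies.\<close>
    also have "(\<Sum>k<d. \<Sum>l<d. \<Sum>i<a. \<Sum>k'<b. \<Sum>l'<b. \<rho> $$ (p * d + k, q * d + l)
            * mat_unit d k l $$ (i * b + k', i * b + l') * C (mat_unit b k' l') $$ (s, t))
        = (\<Sum>i<a. \<Sum>k'<b. \<Sum>l'<b. \<Sum>k<d. \<Sum>l<d. \<rho> $$ (p * d + k, q * d + l)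
            * mat_unit d k l $$ (i * b + k', i * b + l') * C (mat_unit b k' l') $$ (s, t))"
      by (subst sum_rotate, rule sum.cong[OF refl], subst sum_rotate, rule sum.cong[OF refl], rule sum_rotate)
    also have "\<dots> = (\<Sum>i<a. \<Sum>k'<b. \<Sum>l'<b.
        \<rho> $$ (p * d + (i * b + k'), q * d + (i * b + l')) * C (mat_unit b k' l') $$ (s, t))"
      unfolding sum_distrib_right[symmetric] using lt
      by (intro sum.cong refl arg_cong2[of _ _ _ _ "(*)"] sum_mat_unit) auto
    also have "\<dots> = (\<Sum>i<a. tensor_map (d * a) (d * a) b a id C \<rho> $$ ((p * a + i) * a + s, (q * a + i) * a + t))"
    proof (rule sum.cong[OF refl])
      fix i assume "i \<in> {..<a}"
      then have "tensor_map (d * a) (d * a) b a id C \<rho> $$ ((p * a + i) * a + s, (q * a + i) * a + t)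
          = (\<Sum>k'<b. \<Sum>l'<b. \<rho> $$ ((p * a + i) * b + k', (q * a + i) * b + l') * C (mat_unit b k' l') $$ (s, t))"
        using * by (intro tensor_map_id_entry Cc pair_index_less) auto
      then show "(\<Sum>k'<b. \<Sum>l'<b. \<rho> $$ (p * d + (i * b + k'), q * d + (i * b + l')) * C (mat_unit b k' l') $$ (s, t))
          = tensor_map (d * a) (d * a) b a id C \<rho> $$ ((p * a + i) * a + s, (q * a + i) * a + t)"
        by (simp add: d_def algebra_simps)
    qed
    also have "\<dots> = signal_local a b C \<rho> $$ (r, c)"
    proof -
      have "r div a = p" "r mod a = s" "c div a = q" "c mod a = t" using * by simp_all
      then show ?thesis using rc unfolding signal_local_def d_def by simp
    qed
    also have "signal_swap a b \<rho> $$ (r, c) - signal_local a b C \<rho> $$ (r, c)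
        = (signal_swap a b \<rho> - signal_local a b C \<rho>) $$ (r, c)"
      using rc by (simp add: signal_local_def d_def)
    finally show "tensor_map d d d a id ?L \<rho> $$ (r, c) = (signal_swap a b \<rho> - signal_local a b C \<rho>) $$ (r, c)" .
  qed (simp_all add: tensor_map_def signal_local_def d_def)
  then show ?thesis unfolding d_def .
qed

lemma signalling_swap_bounds:
  assumes a: "1 \<le> a" and b: "1 \<le> b" and U: "pulls (a * b) (b * a) (swap_idx a b) U"
  shows "2 - 2 / real a \<le> signalling a b b a U" "signalling a b b a U \<le> 2"
proof -
  let ?D = "\<lambda>C. diamond_norm (a * b) a
       (\<lambda>\<rho>. tensor_map b 1 a a trace_map id (U \<rho>) - tensor_map a 1 b a trace_map C \<rho>)"
  have upper: "?D C \<le> 2" if C: "C \<in> channels b a" for C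
    using a b signalling_map_split[OF C U] signal_swap_states signal_local_states[OF C]
    by (intro diamond_norm_diff_le) auto
  have lower: "2 - 2 / real a \<le> ?D C" if C: "C \<in> channels b a" for C
  proof -
    define \<sigma> where "\<sigma> = C (mat_unit b 0 0)"
    have "trace \<sigma> = 1"
      using channel_trace[OF C mat_unit_carrier] basis_state[of 0 b] b by (auto simp: \<sigma>_def states_def)
    then have "(\<Sum>i<a. Re (\<sigma> $$ (i, i))) = 1"
      using trace_carrier[OF channel_carrier[OF C mat_unit_carrier]]
      unfolding \<sigma>_def by (metis Re_sum one_complex.simps(1))
    \<comment> \<open>The input state may depend on \<open>C\<close>: the diagonal of \<sigma> has
      \<open>a\<close> entries with sum 1, so they cannot all exceed the average.\<close>
    have "\<exists>i<a. Re (\<sigma> $$ (i, i)) \<le> 1 / real a"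
    proof (rule ccontr)
      assume "\<not> ?thesis"
      then have "(\<Sum>i<a. 1 / real a) < (\<Sum>i<a. Re (\<sigma> $$ (i, i)))"
        using a by (intro sum_strict_mono) (auto simp: not_le lessThan_empty_iff)
      then show False using \<open>(\<Sum>i<a. Re (\<sigma> $$ (i, i))) = 1\<close> a by simp
    qed
    then obtain i where i: "i < a" "Re (\<sigma> $$ (i, i)) \<le> 1 / real a" by blast
    \<comment> \<open>Index \<open>i * b\<close> stands for E in state 0, A in state i and B in
      state 0.\<close>
    define \<rho> where "\<rho> = mat_unit (a * b * (a * b)) (i * b) (i * b)"
    have ib: "i * b < a * b" using i b by simp
    have ab: "a * b \<le> a * b * (a * b)" using a b by simp
    have \<rho>: "\<rho> \<in> states (a * b * (a * b))"
      unfolding \<rho>_def by (rule basis_state[OF less_le_trans[OF ib ab]])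
    have \<rho>E: "\<rho> $$ (r, c) = (if r = i * b \<and> c = i * b then 1 else 0)" if "r < a * b" "c < a * b" for r c
      using less_le_trans[OF that(1) ab] less_le_trans[OF that(2) ab] unfolding \<rho>_def mat_unit_def by simp
    have "1 \<le> b * a" using a b by simp
    then have "a * 1 \<le> a * (b * a)" by (rule mult_le_mono2)
    then have aab: "a \<le> a * b * a" by (simp only: mult_1_right mult.assoc)
    \<comment> \<open>As an index of E B', \<open>i\<close> means E in state 0 and B' in state i.
      This entry is 1 for SWAP and at most 1/a for the local map, whence 2 (1 - 1/a).\<close>
    have j: "i < a * b * a" by (rule less_le_trans[OF i(1) aab])
    have "signal_swap a b \<rho> $$ (i, i) = (\<Sum>y<b. if y = 0 then 1 else 0)"
      unfolding signal_swap_def using j i(1) by (auto simp: \<rho>E pair_index_less intro!: sum.cong)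
    then have Pj: "signal_swap a b \<rho> $$ (i, i) = 1" using b by simp
    have "tensor_map (a * b * a) (a * b * a) b a id C \<rho> $$ (x * a + i, x * a + i)
        = (if x = i then \<sigma> $$ (i, i) else 0)" if x: "x < a" for x
    proof -
      have "x < a * b * a" by (rule less_le_trans[OF x aab])
      then have "tensor_map (a * b * a) (a * b * a) b a id C \<rho> $$ (x * a + i, x * a + i)
        = (\<Sum>k<b. \<Sum>l<b. \<rho> $$ (x * b + k, x * b + l) * C (mat_unit b k l) $$ (i, i))"
        using i(1) by (intro tensor_map_id_entry channel_carrier[OF C]) auto
      also have "\<dots> = (\<Sum>k<b. \<Sum>l<b. (if x = i then C (mat_unit b k l) $$ (i, i) else 0) * mat_unit b k l $$ (0, 0))"
      proof (intro sum.cong refl)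
        fix k l assume kl: "k \<in> {..<b}" "l \<in> {..<b}"
        have eq: "x * b + h = i * b \<longleftrightarrow> x = i \<and> h = 0" if "h < b" for h
          using that by (metis add_0_right gr_implies_not0 not_gr0 pair_index_div pair_index_mod add.right_neutral)
        show "\<rho> $$ (x * b + k, x * b + l) * C (mat_unit b k l) $$ (i, i)
          = (if x = i then C (mat_unit b k l) $$ (i, i) else 0) * mat_unit b k l $$ (0, 0)"
          using kl x eq[of k] eq[of l] by (subst \<rho>E) (auto intro: pair_index_less simp: mat_unit_def)
      qed
      also have "\<dots> = (if x = i then \<sigma> $$ (i, i) else 0)"
        unfolding \<sigma>_def using b by (subst sum_mat_unit) auto
      finally show ?thesis .
    qed
    then have "signal_local a b C \<rho> $$ (i, i) = (\<Sum>x<a. if x = i then \<sigma> $$ (i, i) else 0)"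
      unfolding signal_local_def using j i(1) by simp
    then have Qj: "signal_local a b C \<rho> $$ (i, i) = \<sigma> $$ (i, i)" using i(1) by simp
    have "2 * Re (signal_swap a b \<rho> $$ (i, i) - signal_local a b C \<rho> $$ (i, i)) \<le> ?D C"
      by (rule diamond_norm_diff_ge[OF signalling_map_split[OF C U] signal_swap_states signal_local_states[OF C] \<rho> j])
    then show ?thesis using Pj Qj i(2) by simp
  qed
  have ne: "channels b a \<noteq> {}" using a by (rule channels_nonempty)
  show "2 - 2 / real a \<le> signalling a b b a U"
    unfolding signalling_def using ne lower by (intro cINF_greatest) auto
  obtain C where C: "C \<in> channels b a" using ne by blast
  \<comment> \<open>The lower bound serves a second time here: it licenses comparing the real
    infimum with the value at one channel.\<close>
  have "bdd_below (?D ` channels b a)" using lower by (intro bdd_belowI[of _ "2 - 2 / real a"]) auto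
  then have "signalling a b b a U \<le> ?D C" unfolding signalling_def using C by (rule cINF_lower)
  then show "signalling a b b a U \<le> 2" using upper[OF C] by simp
qed

subsection \<open>Causal influence of the SWAP gate\<close>

lemma states_permute:
  assumes "\<rho> \<in> states D" "\<And>r. r < d' \<Longrightarrow> f r < D"
    "(\<Sum>r<d'. \<rho> $$ (f r, f r)) = (\<Sum>r<D. \<rho> $$ (r, r))"
  shows "mat d' d' (\<lambda>(r, c). \<rho> $$ (f r, f c)) \<in> states d'"
  using states_pull[of \<rho> D "{0::nat}" d' "\<lambda>_. f"] assms by simp

section \<open>The inverse of SWAP and the channel T\<close>

lemma pulls_inverse_channel:
  assumes U: "pulls (a * b) (b * a) (swap_idx a b) U"
  shows "pulls (b * a) (a * b) (swap_idx b a) (inverse_channel (a * b) U)"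
proof -
  let ?V = "swap_channel b a"
  have V: "pulls (b * a) (a * b) (swap_idx b a) ?V" by (rule pulls_swap_channel)
  have VU: "?V (U X) = X" if "X \<in> carrier_mat (a * b) (a * b)" for X
    using pulls_unique[OF pulls_cong[OF pulls_comp[OF U V]] pulls_id that]
    by (simp add: swap_idx_swap_idx)
  have UV: "U (?V X) = X" if "X \<in> carrier_mat (b * a) (b * a)" for X
    using pulls_unique[OF pulls_cong[OF pulls_comp[OF V U]] pulls_id that]
    by (simp add: swap_idx_swap_idx)
  \<comment> \<open>\<open>inv_into\<close> is determined only at images of points where
    \<open>U\<close> is injective. \<open>VU\<close> gives the injectivity and \<open>UV\<close> the
    preimages, so the inverse agrees with the opposite SWAP on the carrier.\<close>
  have inj: "inj_on U (carrier_mat (a * b) (a * b))" by (rule inj_on_inverseI[where g = ?V]) (rule VU)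
  have "inverse_channel (a * b) U X = ?V X" if "X \<in> carrier_mat (b * a) (b * a)" for X
    unfolding inverse_channel_def
    by (rule inv_into_f_eq[OF inj pulls_carrier[OF V that] UV[OF that]])
  then show ?thesis using V unfolding pulls_def by simp
qed

text \<open>The index form of T(S) on A A' B', of dimensions a, b, a: the outer digits change places
  and the digit of A' stays.\<close>

definition exchange_idx :: "nat \<Rightarrow> nat \<Rightarrow> nat \<Rightarrow> nat" where
  "exchange_idx a b r = (r mod a * b + r div a mod b) * a + r div a div b"

lemma exchange_idx_triple [simp]:
  "y < b \<Longrightarrow> z < a \<Longrightarrow> exchange_idx a b ((x * b + y) * a + z) = (z * b + y) * a + x"
  by (simp add: exchange_idx_def)

lemma exchange_idx_less: "r < a * b * a \<Longrightarrow> exchange_idx a b r < a * b * a"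
  by (elim pair_index_cases) (simp add: pair_index_less)

text \<open>The index maps are followed from the last channel applied to the first, so the digits
  (x, y, z) become (x, z, y), then (z, x, y), then (z, y, x).\<close>

lemma pulls_T_channel:
  assumes U: "pulls (a * b) (b * a) (swap_idx a b) U"
  shows "pulls (a * b * a) (a * b * a) (exchange_idx a b) (T_channel a b b a U)"
proof -
  let ?f1 = "\<lambda>r. r div (a * b) * (b * a) + swap_idx b a (r mod (a * b))"
  let ?f2 = "\<lambda>r. swap_idx a a (r div b) * b + r mod b"
  let ?f3 = "\<lambda>r. r div (b * a) * (a * b) + swap_idx a b (r mod (b * a))"
  have F1: "pulls (a * b * a) (a * a * b) ?f1
      (tensor_map a a (b * a) (a * b) id (inverse_channel (a * b) U))"
    using pulls_tensor[OF pulls_id pulls_inverse_channel[OF U]] by (simp add: mult.assoc)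
  have F2: "pulls (a * a * b) (a * a * b) ?f2 (tensor_map (a * a) (a * a) b b (swap_channel a a) id)"
    by (rule pulls_tensor[OF pulls_swap_channel pulls_id])
  have F3: "pulls (a * a * b) (a * b * a) ?f3 (tensor_map a a (a * b) (b * a) id U)"
    using pulls_tensor[OF pulls_id U] by (simp add: mult.assoc)
  have "?f1 (?f2 (?f3 r)) = exchange_idx a b r" if "r < a * b * a" for r
  proof -
    obtain x y z where *: "x < a" "y < b" "z < a" "r = (x * b + y) * a + z"
      using \<open>r < a * b * a\<close> by (metis pair_index_cases)
    have less: "y * a + z < b * a" "x * b + y < a * b" using * by (auto intro: pair_index_less)
    have "r = x * (b * a) + (y * a + z)" using * by (simp add: algebra_simps)
    then have "?f3 r = x * (a * b) + (z * b + y)"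
      by (simp only: pair_index_div[OF less(1)] pair_index_mod[OF less(1)] swap_idx_pair[OF *(3)])
    also have "\<dots> = (x * a + z) * b + y" by (simp add: algebra_simps)
    also have "?f2 \<dots> = (z * a + x) * b + y" using * by simp
    also have "\<dots> = z * (a * b) + (x * b + y)" by (simp add: algebra_simps)
    also have "?f1 \<dots> = z * (b * a) + (y * a + x)"
      by (simp only: pair_index_div[OF less(2)] pair_index_mod[OF less(2)] swap_idx_pair[OF *(2)])
    also have "\<dots> = (z * b + y) * a + x" by (simp add: algebra_simps)
    also have "\<dots> = exchange_idx a b r" unfolding *(4) exchange_idx_triple[OF *(2,3)] ..
    finally show ?thesis .
  qed
  then show ?thesis unfolding T_channel_def
    by (intro pulls_cong[OF pulls_comp[OF F1 pulls_comp[OF F2 F3]]]) (simp add: comp_assoc)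
qed

text \<open>T(S) extended by a reference system of dimension \<open>m\<close>.\<close>

definition causal_swap :: "nat \<Rightarrow> nat \<Rightarrow> nat \<Rightarrow> cmat \<Rightarrow> cmat" where
  "causal_swap m a b \<rho> = mat (m * (a * b * a)) (m * (a * b * a)) (\<lambda>(r, c).
     \<rho> $$ (r div (a * b * a) * (a * b * a) + exchange_idx a b (r mod (a * b * a)),
           c div (a * b * a) * (a * b * a) + exchange_idx a b (c mod (a * b * a))))"

text \<open>The last two factors of \<open>\<complex>\<^sup>m \<otimes> \<complex>\<^sup>w \<otimes> \<complex>\<^sup>a\<close> are exchanged before and after
  applying \<open>C\<close> to \<open>\<complex>\<^sup>w\<close>.\<close>

definition swap_last :: "nat \<Rightarrow> nat \<Rightarrow> nat \<Rightarrow> nat" where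
  "swap_last a w r = (r div w div a * w + r mod w) * a + r div w mod a"

text \<open>Here \<open>w\<close> is the dimension of A A'. The conjugation turns C \<otimes> I into
  id \<otimes> C with the reference and B' as bystander, the form in which complete positivity is
  stated.\<close>

definition causal_local :: "nat \<Rightarrow> nat \<Rightarrow> nat \<Rightarrow> (cmat \<Rightarrow> cmat) \<Rightarrow> cmat \<Rightarrow> cmat" where
  "causal_local m w a C \<rho> = mat (m * w * a) (m * w * a) (\<lambda>(r, c).
     tensor_map (m * a) (m * a) w w id C
       (mat (m * a * w) (m * a * w) (\<lambda>(r, c). \<rho> $$ (swap_last a w r, swap_last a w c)))
     $$ (swap_last w a r, swap_last w a c))"

lemma swap_last_triple [simp]:
  "x < a \<Longrightarrow> y < w \<Longrightarrow> swap_last a w ((p * a + x) * w + y) = (p * w + y) * a + x"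
  by (simp add: swap_last_def)

lemma swap_last_less: "r < m * a * w \<Longrightarrow> swap_last a w r < m * w * a"
  by (elim pair_index_cases) (simp add: pair_index_less)

lemma sum_swap_last:
  "(\<Sum>r<m * a * w. g (swap_last a w r)) = (\<Sum>r<m * w * a. (g r :: 'a::comm_monoid_add))"
proof -
  have "(\<Sum>r<m * a * w. g (swap_last a w r)) = (\<Sum>p<m. \<Sum>x<a. \<Sum>y<w. g ((p * w + y) * a + x))"
    unfolding sum_index_product by (intro sum.cong refl) (simp only: swap_last_triple lessThan_iff)
  also have "\<dots> = (\<Sum>p<m. \<Sum>y<w. \<Sum>x<a. g ((p * w + y) * a + x))"
    by (rule sum.cong[OF refl], rule sum.swap)
  finally show ?thesis unfolding sum_index_product .
qed

lemma causal_swap_states: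
  assumes \<rho>: "\<rho> \<in> states (m * (a * b * a))" shows "causal_swap m a b \<rho> \<in> states (m * (a * b * a))"
  unfolding causal_swap_def
proof (rule states_permute[OF \<rho>])
  fix r assume "r < m * (a * b * a)"
  then show "r div (a * b * a) * (a * b * a) + exchange_idx a b (r mod (a * b * a)) < m * (a * b * a)"
    using div_mod_less[of r m "a * b * a"] by (intro pair_index_less exchange_idx_less)
next
  \<comment> \<open>Exchanging digits permutes the indices, so the trace does not change.\<close>
  have inner: "(\<Sum>s<a * b * a. g (exchange_idx a b s)) = (\<Sum>s<a * b * a. g s)" for g :: "nat \<Rightarrow> complex"
  proof -
    have "(\<Sum>s<a * b * a. g (exchange_idx a b s)) = (\<Sum>x<a. \<Sum>y<b. \<Sum>z<a. g ((z * b + y) * a + x))"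
      unfolding sum_index_product by (intro sum.cong refl) (simp only: exchange_idx_triple lessThan_iff)
    also have "\<dots> = (\<Sum>z<a. \<Sum>x<a. \<Sum>y<b. g ((z * b + y) * a + x))" by (rule sum_rotate)
    also have "\<dots> = (\<Sum>z<a. \<Sum>y<b. \<Sum>x<a. g ((z * b + y) * a + x))"
      by (rule sum.cong[OF refl], rule sum.swap)
    finally show ?thesis unfolding sum_index_product .
  qed
  define d where "d = a * b * a"
  show "(\<Sum>r<m * (a * b * a). \<rho> $$ (r div (a * b * a) * (a * b * a) + exchange_idx a b (r mod (a * b * a)),
        r div (a * b * a) * (a * b * a) + exchange_idx a b (r mod (a * b * a))))
      = (\<Sum>r<m * (a * b * a). \<rho> $$ (r, r))"
    unfolding sum_index_product[of _ m "a * b * a"] inner[of "\<lambda>s. \<rho> $$ (_ * (a * b * a) + s, _ * (a * b * a) + s)", symmetric]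
    by (intro sum.cong refl) (simp only: pair_index_div pair_index_mod lessThan_iff)
qed

lemma causal_local_states:
  assumes C: "C \<in> channels w w" and \<rho>: "\<rho> \<in> states (m * w * a)"
  shows "causal_local m w a C \<rho> \<in> states (m * w * a)"
  unfolding causal_local_def
  by (intro states_permute[of _ "m * a * w"] channel_tensor_states[OF C] states_permute[OF \<rho>]
      swap_last_less sum_swap_last)

lemma causal_map_split:
  assumes C: "C \<in> channels (a * b) (a * b)" and U: "pulls (a * b) (b * a) (swap_idx a b) U"
    and \<rho>: "\<rho> \<in> states (a * b * a * (a * b * a))"
  shows "tensor_map (a * b * a) (a * b * a) (a * b * a) (a * b * a) id
      (\<lambda>\<rho>. T_channel a b b a U \<rho> - tensor_map (a * b) (a * b) a a C id \<rho>) \<rho>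
    = causal_swap (a * b * a) a b \<rho> - causal_local (a * b * a) (a * b) a C \<rho>"
    (is "tensor_map _ _ _ _ id ?L \<rho> = _")
proof -
  define w where "w = a * b"
  define m where "m = w * a"
  note T = pulls_T_channel[OF U, folded w_def, folded m_def]
  have Cc: "C (mat_unit w k l) \<in> carrier_mat w w" for k l
    unfolding w_def by (rule channel_carrier[OF C]) simp
  have Lc: "?L X \<in> carrier_mat m m" for X
    using tensor_map_carrier[of w w a a C id X] by (simp add: minus_mat_def m_def w_def)
  have LE: "?L (mat_unit m k l) $$ (u * a + z, u' * a + z')
      = mat_unit m k l $$ (exchange_idx a b (u * a + z), exchange_idx a b (u' * a + z'))
        - (\<Sum>i<w. \<Sum>j<w. mat_unit m k l $$ (i * a + z, j * a + z') * C (mat_unit w i j) $$ (u, u'))"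
    if uz: "u < w" "z < a" "u' < w" "z' < a" for k l u z u' z'
  proof -
    have less: "u * a + z < m" "u' * a + z' < m" unfolding m_def using uz by (auto intro: pair_index_less)
    have "tensor_map w w a a C id (mat_unit m k l) $$ (u * a + z, u' * a + z')
        = (\<Sum>i<w. \<Sum>j<w. \<Sum>h<a. \<Sum>h'<a. (mat_unit m k l $$ (i * a + h, j * a + h') * C (mat_unit w i j) $$ (u, u'))
            * mat_unit a h h' $$ (z, z'))"
      by (subst tensor_map_entry) (use uz Cc in \<open>auto simp: mult.assoc\<close>)
    also have "\<dots> = (\<Sum>i<w. \<Sum>j<w. mat_unit m k l $$ (i * a + z, j * a + z') * C (mat_unit w i j) $$ (u, u'))"
      by (intro sum.cong[OF refl] sum_mat_unit uz)
    finally show ?thesis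
      using less pulls_entry[OF T mat_unit_carrier less] tensor_map_carrier[of w w a a C id "mat_unit m k l"]
      by (simp add: w_def m_def)
  qed
  have "tensor_map m m m m id ?L \<rho> = causal_swap m a b \<rho> - causal_local m w a C \<rho>"
  proof (rule eq_matI)
    fix r c assume "r < dim_row (causal_swap m a b \<rho> - causal_local m w a C \<rho>)"
      "c < dim_col (causal_swap m a b \<rho> - causal_local m w a C \<rho>)"
    then have rc: "r < m * w * a" "c < m * w * a" by (auto simp: causal_local_def)
    \<comment> \<open>The digits \<open>p\<close>, \<open>u\<close>, \<open>z\<close> index the
      reference, A A' and B'. Grouping the first two suits \<open>causal_local\<close>; grouping the
      last two (\<open>r'\<close>, \<open>c'\<close>) suits \<open>tensor_map\<close> and
      \<open>causal_swap\<close>.\<close>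
    then obtain p u z q u' z' where *: "p < m" "u < w" "z < a" "q < m" "u' < w" "z' < a"
      and r: "r = (p * w + u) * a + z" and c: "c = (q * w + u') * a + z'"
      by (metis pair_index_cases)
    have r': "r = p * m + (u * a + z)" and c': "c = q * m + (u' * a + z')"
      unfolding r c m_def by (simp_all add: algebra_simps)
    have less: "u * a + z < m" "u' * a + z' < m" unfolding m_def using * by (auto intro: pair_index_less)
    have lt: "x * a + y < m" if "x < w" "y < a" for x y
      using that unfolding m_def by (rule pair_index_less)
    define s where "s = exchange_idx a b (u * a + z)"
    define s' where "s' = exchange_idx a b (u' * a + z')"
    have s: "s < m" "s' < m"
      using less exchange_idx_less unfolding s_def s'_def m_def w_def by auto
    \<comment> \<open>The input with B' moved in front of A A', as it occurs inside
      \<open>causal_local\<close>.\<close>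
    define \<rho>' where "\<rho>' = mat (m * a * w) (m * a * w) (\<lambda>(r, c). \<rho> $$ (swap_last a w r, swap_last a w c))"
    have "tensor_map m m m m id ?L \<rho> $$ (r, c)
        = (\<Sum>k<m. \<Sum>l<m. \<rho> $$ (p * m + k, q * m + l) * ?L (mat_unit m k l) $$ (u * a + z, u' * a + z'))"
      unfolding r' c' using * less by (intro tensor_map_id_entry Lc)
    also have "\<dots> = (\<Sum>k<m. \<Sum>l<m. \<rho> $$ (p * m + k, q * m + l) * mat_unit m k l $$ (s, s'))
        - (\<Sum>k<m. \<Sum>l<m. \<Sum>i<w. \<Sum>j<w. \<rho> $$ (p * m + k, q * m + l)
            * mat_unit m k l $$ (i * a + z, j * a + z') * C (mat_unit w i j) $$ (u, u'))"
      unfolding LE[OF *(2,3,5,6)] s_def[symmetric] s'_def[symmetric]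
        right_diff_distrib sum_subtractf sum_distrib_left mult.assoc ..
    also have "(\<Sum>k<m. \<Sum>l<m. \<rho> $$ (p * m + k, q * m + l) * mat_unit m k l $$ (s, s'))
        = \<rho> $$ (p * m + s, q * m + s')"
      using s by (rule sum_mat_unit)
    also have "\<dots> = causal_swap m a b \<rho> $$ (r, c)"
    proof -
      have "r div (a * b * a) = p" "r mod (a * b * a) = u * a + z"
        "c div (a * b * a) = q" "c mod (a * b * a) = u' * a + z'"
        unfolding r' c' using less by (simp_all add: m_def w_def)
      then show ?thesis
        using rc unfolding causal_swap_def by (simp add: m_def w_def s_def s'_def mult.assoc)
    qed
    also have "(\<Sum>k<m. \<Sum>l<m. \<Sum>i<w. \<Sum>j<w. \<rho> $$ (p * m + k, q * m + l)
            * mat_unit m k l $$ (i * a + z, j * a + z') * C (mat_unit w i j) $$ (u, u'))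
        = (\<Sum>i<w. \<Sum>j<w. \<Sum>k<m. \<Sum>l<m. \<rho> $$ (p * m + k, q * m + l)
            * mat_unit m k l $$ (i * a + z, j * a + z') * C (mat_unit w i j) $$ (u, u'))"
      by (subst sum_rotate, rule sum.cong[OF refl], rule sum_rotate)
    also have "\<dots> = (\<Sum>i<w. \<Sum>j<w.
        \<rho> $$ (p * m + (i * a + z), q * m + (j * a + z')) * C (mat_unit w i j) $$ (u, u'))"
      unfolding sum_distrib_right[symmetric] using lt *
      by (intro sum.cong refl arg_cong2[of _ _ _ _ "(*)"] sum_mat_unit) auto
    also have "\<dots> = (\<Sum>i<w. \<Sum>j<w. \<rho>' $$ ((p * a + z) * w + i, (q * a + z') * w + j) * C (mat_unit w i j) $$ (u, u'))"
    proof (intro sum.cong refl arg_cong2[of _ _ _ _ "(*)"])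
      fix i j assume "i \<in> {..<w}" "j \<in> {..<w}"
      then have "\<rho>' $$ ((p * a + z) * w + i, (q * a + z') * w + j) = \<rho> $$ ((p * w + i) * a + z, (q * w + j) * a + z')"
        unfolding \<rho>'_def using * by (simp add: pair_index_less)
      then show "\<rho> $$ (p * m + (i * a + z), q * m + (j * a + z')) = \<rho>' $$ ((p * a + z) * w + i, (q * a + z') * w + j)"
        by (simp add: m_def algebra_simps)
    qed
    also have "\<dots> = tensor_map (m * a) (m * a) w w id C \<rho>' $$ ((p * a + z) * w + u, (q * a + z') * w + u')"
      using * by (intro tensor_map_id_entry[symmetric] Cc pair_index_less)
    also have "\<dots> = causal_local m w a C \<rho> $$ (r, c)"
      using rc * unfolding causal_local_def \<rho>'_def[symmetric] r c by simp
    also have "causal_swap m a b \<rho> $$ (r, c) - causal_local m w a C \<rho> $$ (r, c)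
        = (causal_swap m a b \<rho> - causal_local m w a C \<rho>) $$ (r, c)"
      using rc by (simp add: causal_local_def)
    finally show "tensor_map m m m m id ?L \<rho> $$ (r, c) = (causal_swap m a b \<rho> - causal_local m w a C \<rho>) $$ (r, c)" .
  qed (simp_all add: tensor_map_def causal_local_def m_def mult.assoc)
  then show ?thesis unfolding w_def m_def .
qed

lemma causal_influence_swap:
  assumes a: "2 \<le> a" and b: "1 \<le> b" and U: "pulls (a * b) (b * a) (swap_idx a b) U"
  shows "causal_influence a b b a U = 2"
proof -
  define w where "w = a * b"
  define m where "m = w * a"
  let ?D = "\<lambda>C. diamond_norm (a * b * a) (a * b * a)
       (\<lambda>\<rho>. T_channel a b b a U \<rho> - tensor_map (a * b) (a * b) a a C id \<rho>)"
  have m0: "0 < m" using a b by (simp add: m_def w_def)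
  have "?D C = 2" if C: "C \<in> channels (a * b) (a * b)" for C
  proof (rule antisym)
    have Q: "causal_local m w a C \<rho> \<in> states (m * m)" if "\<rho> \<in> states (m * m)" for \<rho>
      using causal_local_states[of C w \<rho> m a] C that by (simp add: m_def w_def mult.assoc)
    have P: "causal_swap m a b \<rho> \<in> states (m * m)" if "\<rho> \<in> states (m * m)" for \<rho>
      using causal_swap_states[of \<rho> m a b] that by (simp add: m_def w_def)
    note split = causal_map_split[OF C U, folded w_def, folded m_def]
    show "?D C \<le> 2" unfolding w_def[symmetric] m_def[symmetric]
      using m0 split P Q by (rule diamond_norm_diff_le)
    \<comment> \<open>Index 1 means B' in state 1 and all other factors in state 0; such a state of
      B' exists because \<open>a \<ge> 2\<close>.\<close>
    define \<rho> where "\<rho> = mat_unit (m * m) 1 1"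
    have "1 * b < a * b" using a b by (intro mult_strict_right_mono) auto
    then have bw: "b < w" by (simp add: w_def)
    then have bm: "b * a < m" using a by (simp add: m_def)
    have "a \<le> b * a" using b by simp
    then have m1: "1 < m" using a bm by linarith
    have mm: "m \<le> m * m" using m0 by simp
    have \<rho>: "\<rho> \<in> states (m * m)" unfolding \<rho>_def by (rule basis_state[OF less_le_trans[OF m1 mm]])
    have \<rho>E: "\<rho> $$ (r, c) = (if r = 1 \<and> c = 1 then 1 else 0)" if "r < m" "c < m" for r c
      using less_le_trans[OF that(1) mm] less_le_trans[OF that(2) mm] unfolding \<rho>_def mat_unit_def by simp
    \<comment> \<open>Index \<open>b * a\<close> has the digits A = 1, A' = 0, B' = 0 and reference
      0: the image of the chosen basis state when A and B' are exchanged.\<close>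
    have j: "b * a < m * m" by (rule less_le_trans[OF bm mm])
    have "exchange_idx a b ((1 * b + 0) * a + 0) = (0 * b + 0) * a + 1"
      using a b by (intro exchange_idx_triple) auto
    then have "causal_swap m a b \<rho> $$ (b * a, b * a) = \<rho> $$ (1, 1)"
      unfolding causal_swap_def w_def[symmetric] m_def[symmetric] using j bm by simp
    then have Pj: "causal_swap m a b \<rho> $$ (b * a, b * a) = 1" using \<rho>E[OF m1 m1] by simp
    define \<rho>' where "\<rho>' = mat (m * a * w) (m * a * w) (\<lambda>(r, c). \<rho> $$ (swap_last a w r, swap_last a w c))"
    \<comment> \<open>The indices below \<open>w\<close> are those with reference and B' in state 0,
      where the input vanishes. A map acting on A A' alone computes the entry in question from this
      block only.\<close>
    have z: "\<rho>' $$ (k, l) = 0" if "k < w" "l < w" for k l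
    proof -
      have "1 \<le> m * a" using m0 a by simp
      then have "1 * w \<le> m * a * w" by (rule mult_le_mono1)
      then have lt: "k < m * a * w" "l < m * a * w" using that by linarith+
      have "swap_last a w k = k * a" "swap_last a w l = l * a"
        using that a by (simp_all add: swap_last_def)
      moreover have "k * a < m" "l * a < m" using that a by (simp_all add: m_def)
      moreover have "k * a \<noteq> 1" using a by simp
      ultimately show ?thesis using lt unfolding \<rho>'_def by (simp add: \<rho>E)
    qed
    have "swap_last w a ((0 * w + b) * a + 0) = (0 * a + 0) * w + b"
      using a bw by (intro swap_last_triple) auto
    then have "causal_local m w a C \<rho> $$ (b * a, b * a)
        = tensor_map (m * a) (m * a) w w id C \<rho>' $$ ((0 * a + 0) * w + b, (0 * a + 0) * w + b)"
      unfolding causal_local_def \<rho>'_def using j by (simp add: m_def mult.assoc)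
    also have "\<dots> = (\<Sum>k<w. \<Sum>l<w. \<rho>' $$ ((0 * a + 0) * w + k, (0 * a + 0) * w + l) * C (mat_unit w k l) $$ (b, b))"
      using bw m0 a channel_carrier[OF C] unfolding w_def by (intro tensor_map_id_entry) auto
    also have "\<dots> = 0" by (simp add: z)
    finally have Qj: "causal_local m w a C \<rho> $$ (b * a, b * a) = 0" .
    have "2 * Re (causal_swap m a b \<rho> $$ (b * a, b * a) - causal_local m w a C \<rho> $$ (b * a, b * a)) \<le> ?D C"
      unfolding w_def[symmetric] m_def[symmetric]
      by (rule diamond_norm_diff_ge[OF split P Q \<rho> j])
    then show "2 \<le> ?D C" unfolding Pj Qj by simp
  qed
  \<comment> \<open>The norm is 2 for every channel, so the infimum is that of a constant over a
    nonempty set.\<close>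
  moreover have "channels (a * b) (a * b) \<noteq> {}" using a b by (intro channels_nonempty) simp
  ultimately show ?thesis unfolding causal_influence_def by (simp cong: INF_cong_simp)
qed

text \<open>The limits are claimed for \<open>dA \<ge> 2\<close>. For \<open>dA = 1\<close> Bob's
  output is trivial at every n and both quantities are 0: discarding everything already has the form
  Tr_A \<otimes> C, and T(S) is the identity.\<close>

theorem mainTheorem7:
  fixes dA dB :: nat
  assumes "dA \<ge> 1" and "dB \<ge> 1"
  shows "(\<forall>n. \<forall>\<rho>\<in>carrier_mat (dA ^ n * dB ^ n) (dA ^ n * dB ^ n).
            tensor_power dA dB dB dA (swap_channel dA dB) n \<rho> = swap_channel (dA ^ n) (dB ^ n) \<rho>)
       \<and> (dA \<ge> 2 \<longrightarrow>
            signalling_power dA dB dB dA (swap_channel dA dB) \<longlonglongrightarrow> 2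
          \<and> asymptotic_signalling dA dB dB dA (swap_channel dA dB) = 2
          \<and> causal_influence_power dA dB dB dA (swap_channel dA dB) \<longlonglongrightarrow> 2
          \<and> asymptotic_causal_influence dA dB dB dA (swap_channel dA dB) = 2)"
proof (intro conjI allI ballI impI)
  let ?S = "swap_channel dA dB"
  fix n and \<rho> :: cmat assume "\<rho> \<in> carrier_mat (dA ^ n * dB ^ n) (dA ^ n * dB ^ n)"
  then show "tensor_power dA dB dB dA ?S n \<rho> = swap_channel (dA ^ n) (dB ^ n) \<rho>"
    by (rule pulls_unique[OF pulls_tensor_power pulls_swap_channel])
next
  let ?S = "swap_channel dA dB"
  assume dA: "dA \<ge> 2"
  have "(\<lambda>n. inverse (real dA ^ n)) \<longlonglongrightarrow> 0" using dA by (intro LIMSEQ_inverse_realpow_zero) simp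
  then have "(\<lambda>n. 2 - 2 * inverse (real dA ^ n)) \<longlonglongrightarrow> 2 - 2 * 0" by (intro tendsto_intros)
  then have lim: "(\<lambda>n. 2 - 2 / real (dA ^ n)) \<longlonglongrightarrow> 2" by (simp add: divide_inverse)
  have "2 - 2 / real (dA ^ n) \<le> signalling_power dA dB dB dA ?S n \<and>
      signalling_power dA dB dB dA ?S n \<le> 2" for n
    unfolding signalling_power_def using assms
    by (intro conjI signalling_swap_bounds pulls_tensor_power one_le_power)
  then show S: "signalling_power dA dB dB dA ?S \<longlonglongrightarrow> 2"
    by (intro real_tendsto_sandwich[OF _ _ lim tendsto_const]) auto
  \<comment> \<open>The power n = 0 is excluded because its systems are one-dimensional; from n = 1
    on \<open>dA ^ n \<ge> 2\<close> and the sequence is constant.\<close>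
  have "causal_influence_power dA dB dB dA ?S n = 2" if "1 \<le> n" for n
  proof -
    have "dA ^ 1 \<le> dA ^ n" using that assms by (intro power_increasing)
    then show ?thesis
      unfolding causal_influence_power_def using dA assms
      by (intro causal_influence_swap pulls_tensor_power one_le_power) auto
  qed
  then show C: "causal_influence_power dA dB dB dA ?S \<longlonglongrightarrow> 2"
    by (intro tendsto_eventually eventually_sequentiallyI)
  show "asymptotic_signalling dA dB dB dA ?S = 2"
    unfolding asymptotic_signalling_def using S by (rule limI)
  show "asymptotic_causal_influence dA dB dB dA ?S = 2"
    unfolding asymptotic_causal_influence_def using C by (rule limI)
qed

end
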